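(* Let $n\ge 2$, $0<\alpha<1$, $A>0$, and let $a$ and $b$ be positive constants and $z\in\mathcal{P}_\alpha$. Then $$E_z\big[\exp\big(b\,|B_{\tau_\alpha}|^a\big)\big]<\infty \quad\text{if and only if}\quad E_z\big[\exp\big(b\,(B^*_{\tau_\alpha})^a\big)\big]<\infty .$$
   Context: $\mathcal{P}_\alpha=\{(x,Y)\in\mathbb{R}\times\mathbb{R}^{n-1}: x>0,\ |Y|<Ax^\alpha\}$ is a parabola-shaped region in $\mathbb{R}^n$. $\{B_t:t\ge 0\}$ is $n$-dimensional Brownian motion; $P_z$ and $E_z$ are the probability and expectation associated with this motion started at $z$. $\tau_\alpha=\inf\{t>0: B_t\notin\mathcal{P}_\alpha\}$ is the exit time from $\mathcal{P}_\alpha$, $B_{\tau_\alpha}$ is the exit position, and $B^*_{\tau_\alpha}=\sup\{|B_t|: 0\le t<\tau_\alpha\}$. *)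

theory Defs
  imports "HOL-Probability.Probability"
begin

text \<open>The ambient space \<open>\<real>\<^sup>n = \<real> \<times> \<real>\<^sup>n\<^sup>-\<^sup>1\<close> with \<open>n \<ge> 2\<close> is the type \<open>real \<times> (real ^ 'm)\<close>, where
  \<open>CARD('m) = n - 1\<close>. Since \<open>CARD('m) \<ge> 1\<close> always holds, a statement polymorphic in \<open>'m\<close> covers
  exactly the dimensions \<open>n \<ge> 2\<close>. The norm on this product type is the Euclidean norm.\<close>

definition parabolic_region :: "real \<Rightarrow> real \<Rightarrow> (real \<times> (real ^ 'm)) set" where
  "parabolic_region A \<alpha> = {(x, Y). x > 0 \<and> norm Y < A * x powr \<alpha>}"

text \<open>Density of the centred Gaussian law with covariance matrix \<open>t\<close> times the identity, for \<open>t > 0\<close>.\<close>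

definition gaussian_density :: "real \<Rightarrow> 'a::euclidean_space \<Rightarrow> real" where
  "gaussian_density t x =
     (2 * pi * t) powr (- (real DIM('a) / 2)) * exp (- (norm x)\<^sup>2 / (2 * t))"

text \<open>\<open>B\<close> is a standard Brownian motion under the probability measure \<open>M\<close>, started at the point \<open>z\<close>.
  Time is the half-line \<open>{0..}\<close>; the values \<open>B t\<close> for \<open>t < 0\<close> are irrelevant.\<close>

definition brownian_motion ::
    "'w measure \<Rightarrow> 'a::euclidean_space \<Rightarrow> (real \<Rightarrow> 'w \<Rightarrow> 'a) \<Rightarrow> bool" where
  "brownian_motion M z B \<longleftrightarrow>
     prob_space M \<and>
     (\<forall>t\<ge>0. B t \<in> borel_measurable M) \<and>
     (\<forall>\<omega>\<in>space M. B 0 \<omega> = z) \<and>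
     (\<forall>\<omega>\<in>space M. continuous_on {0..} (\<lambda>t. B t \<omega>)) \<and>
     (\<forall>s t. 0 \<le> s \<and> s < t \<longrightarrow>
        distributed M lborel (\<lambda>\<omega>. B t \<omega> - B s \<omega>) (\<lambda>x. ennreal (gaussian_density (t - s) x))) \<and>
     (\<forall>k (t :: nat \<Rightarrow> real). 0 \<le> t 0 \<and> (\<forall>i<k. t i < t (Suc i)) \<longrightarrow>
        prob_space.indep_vars M (\<lambda>_. borel) (\<lambda>i \<omega>. B (t (Suc i)) \<omega> - B (t i) \<omega>) {..<k})"

text \<open>The exit time is \<open>\<infinity>\<close> if the path stays in \<open>D\<close> forever.\<close>

definition exit_time :: "'a set \<Rightarrow> (real \<Rightarrow> 'w \<Rightarrow> 'a) \<Rightarrow> 'w \<Rightarrow> ereal" where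
  "exit_time D B \<omega> = (INF t\<in>{t. t > 0 \<and> B t \<omega> \<notin> D}. ereal t)"

text \<open>The next two quantities carry their intended meaning where the exit time is finite (and, for
  the second, positive). If it is \<open>\<infinity>\<close>, the first is \<open>B 0 \<omega>\<close> and the supremum in the second may be
  that of an unbounded set of reals, hence unspecified. Brownian motion leaves the region
  \<open>parabolic_region A \<alpha>\<close>, which lies in a half-space, almost surely, so that expectations of
  functions of these quantities do not depend on the values taken there.\<close>

definition exit_position :: "'a set \<Rightarrow> (real \<Rightarrow> 'w \<Rightarrow> 'a) \<Rightarrow> 'w \<Rightarrow> 'a" where
  "exit_position D B \<omega> = B (real_of_ereal (exit_time D B \<omega>)) \<omega>"

definition maximal_norm_before_exit ::
    "'a::real_normed_vector set \<Rightarrow> (real \<Rightarrow> 'w \<Rightarrow> 'a) \<Rightarrow> 'w \<Rightarrow> real" where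
  "maximal_norm_before_exit D B \<omega> = (SUP t\<in>{t. 0 \<le> t \<and> ereal t < exit_time D B \<omega>}. norm (B t \<omega>))"

end

theory Submission
  imports Defs "HOL-Real_Asymp.Real_Asymp"
begin

text \<open>Almost surely the path leaves the region, and then \<open>|B\<^sub>\<tau>| \<le> B\<^sup>*\<^sub>\<tau>\<close>, which is one direction. For the
  other, suppose the path reaches distance \<open>r\<close> from the origin while still inside. The region has
  width of order \<open>r\<^sup>\<alpha>\<close> there, so within the next \<open>r\<^sup>2\<^sup>\<alpha>\<close> time units the path exits after moving by at
  most \<open>C r\<^sup>\<alpha>\<close>, with probability at least some \<open>c > 0\<close> independent of \<open>r\<close>; hence
  \<open>P(|B\<^sub>\<tau>| \<ge> r - C r\<^sup>\<alpha>) \<ge> c P(B\<^sup>*\<^sub>\<tau> > r)\<close>. If \<open>a \<le> 1 - \<alpha>\<close>, the loss \<open>r\<^sup>a - (r - C r\<^sup>\<alpha>)\<^sup>a\<close> is bounded and this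
  tail comparison transfers exponential moments. If \<open>a > 1 - \<alpha>\<close>, both moments are infinite: moving along
  the tube in steps of the size of its width, the path reaches distance \<open>r\<close> with probability at least
  \<open>exp(-C' r\<^sup>1\<^sup>-\<^sup>\<alpha>)\<close>.\<close>

section \<open>Independence of past and future increments\<close>

text \<open>Brownian motion is given here only by independent Gaussian increments at deterministic
  times, yet both estimates restart the path. For the tail comparison, the hitting time of distance
  \<open>r\<close> is replaced by a countable dense set of times at which the path lies in an open
  shell just beyond \<open>r\<close>, split by finite approximation according to the first such
  time. Travelling along the tube uses deterministic step times, so independence of past and future
  is enough. Constants are uniform in \<open>r\<close> by Brownian scaling: an increment over time
  \<open>T\<close>, divided by \<open>sqrt T\<close>, always has the same law, and a width of order
  \<open>r^\<alpha>\<close> is matched with \<open>T = r^(2\<alpha>)\<close>. The exponent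
  \<open>1 - \<alpha>\<close> enters twice. The loss \<open>r^a - (r - C r^\<alpha>)^a\<close> is of
  order \<open>r^(a+\<alpha>-1)\<close>, and steps of local size \<open>r^\<alpha>\<close> need
  about \<open>r^(1-\<alpha>)\<close> repetitions to reach \<open>r\<close>, so their exponential
  cost loses against \<open>exp (b r^a)\<close> for every \<open>b > 0\<close> once
  \<open>a > 1 - \<alpha>\<close>. In that regime the tail comparison turns far positions into far
  exits, so already the smaller moment, that of the exit position, is infinite.\<close>

definition rv_sigma :: "'w set \<Rightarrow> ('i \<Rightarrow> 'w \<Rightarrow> 'a::topological_space) \<Rightarrow> 'i set \<Rightarrow> 'w measure" where
  "rv_sigma \<Omega> X I = sigma \<Omega> (\<Union>i\<in>I. {X i -` S \<inter> \<Omega> | S. S \<in> sets borel})"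

lemma space_rv_sigma [simp]: "space (rv_sigma \<Omega> X I) = \<Omega>"
  unfolding rv_sigma_def by (rule space_measure_of) auto

lemma sets_rv_sigma:
  "sets (rv_sigma \<Omega> X I) = sigma_sets \<Omega> (\<Union>i\<in>I. {X i -` S \<inter> \<Omega> | S. S \<in> sets borel})"
  unfolding rv_sigma_def by (rule sets_measure_of) auto

lemma measurable_rv_sigma: "i \<in> I \<Longrightarrow> X i \<in> borel_measurable (rv_sigma \<Omega> X I)"
  by (rule measurableI) (auto simp: sets_rv_sigma intro!: sigma_sets.Basic)

lemma sets_rv_sigma_le:
  assumes "\<And>i. i \<in> I \<Longrightarrow> X i \<in> borel_measurable N" "space N = \<Omega>"
  shows "sets (rv_sigma \<Omega> X I) \<subseteq> sets N"
  unfolding sets_rv_sigma assms(2)[symmetric]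
  by (rule sets.sigma_sets_subset) (use assms in \<open>auto intro: measurable_sets\<close>)

lemma sets_rv_sigma_mono: "I \<subseteq> J \<Longrightarrow> sets (rv_sigma \<Omega> X I) \<subseteq> sets (rv_sigma \<Omega> X J)"
  by (rule sets_rv_sigma_le) (auto intro: measurable_rv_sigma)

text \<open>Preimages under single variables are not closed under intersection, while the
  sigma-algebras of finite subfamilies form a directed union, which is. Independence of two infinite
  families thereby reduces to finitely many indices.\<close>

lemma rv_sigma_finite_generators:
  "Int_stable (\<Union>J\<in>{J. finite J \<and> J \<subseteq> I}. sets (rv_sigma \<Omega> X J))"
  "sets (rv_sigma \<Omega> X I) = sigma_sets \<Omega> (\<Union>J\<in>{J. finite J \<and> J \<subseteq> I}. sets (rv_sigma \<Omega> X J))"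
proof -
  show "Int_stable (\<Union>J\<in>{J. finite J \<and> J \<subseteq> I}. sets (rv_sigma \<Omega> X J))"
  proof (rule Int_stableI)
    fix a b
    assume "a \<in> (\<Union>J\<in>{J. finite J \<and> J \<subseteq> I}. sets (rv_sigma \<Omega> X J))"
      and "b \<in> (\<Union>J\<in>{J. finite J \<and> J \<subseteq> I}. sets (rv_sigma \<Omega> X J))"
    then obtain J K where J: "finite J" "J \<subseteq> I" "a \<in> sets (rv_sigma \<Omega> X J)"
      and K: "finite K" "K \<subseteq> I" "b \<in> sets (rv_sigma \<Omega> X K)" by blast
    have "a \<in> sets (rv_sigma \<Omega> X (J \<union> K))" "b \<in> sets (rv_sigma \<Omega> X (J \<union> K))"
      using J(3) K(3) sets_rv_sigma_mono[of J "J \<union> K" \<Omega> X] sets_rv_sigma_mono[of K "J \<union> K" \<Omega> X] by auto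
    then have "a \<inter> b \<in> sets (rv_sigma \<Omega> X (J \<union> K))" by blast
    then show "a \<inter> b \<in> (\<Union>J\<in>{J. finite J \<and> J \<subseteq> I}. sets (rv_sigma \<Omega> X J))"
      using J K by blast
  qed
  show "sets (rv_sigma \<Omega> X I) = sigma_sets \<Omega> (\<Union>J\<in>{J. finite J \<and> J \<subseteq> I}. sets (rv_sigma \<Omega> X J))"
  proof
    show "sets (rv_sigma \<Omega> X I) \<subseteq> sigma_sets \<Omega> (\<Union>J\<in>{J. finite J \<and> J \<subseteq> I}. sets (rv_sigma \<Omega> X J))"
      unfolding sets_rv_sigma[of \<Omega> X I]
    proof (rule sigma_sets_mono, rule subsetI)
      fix a assume "a \<in> (\<Union>i\<in>I. {X i -` S \<inter> \<Omega> | S. S \<in> sets borel})"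
      then obtain i S where "i \<in> I" "S \<in> sets borel" "a = X i -` S \<inter> \<Omega>" by blast
      moreover from this have "a \<in> sets (rv_sigma \<Omega> X {i})"
        using measurable_sets[OF measurable_rv_sigma[of i "{i}" X \<Omega>]] by auto
      ultimately show "a \<in> sigma_sets \<Omega> (\<Union>J\<in>{J. finite J \<and> J \<subseteq> I}. sets (rv_sigma \<Omega> X J))"
        by (intro sigma_sets.Basic) (auto intro!: exI[of _ "{i}"])
    qed
    have "(\<Union>J\<in>{J. finite J \<and> J \<subseteq> I}. sets (rv_sigma \<Omega> X J)) \<subseteq> sets (rv_sigma \<Omega> X I)"
      using sets_rv_sigma_mono[of _ I \<Omega> X] by blast
    from sets.sigma_sets_subset[OF this]
    show "sigma_sets \<Omega> (\<Union>J\<in>{J. finite J \<and> J \<subseteq> I}. sets (rv_sigma \<Omega> X J)) \<subseteq> sets (rv_sigma \<Omega> X I)"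
      by simp
  qed
qed

locale brownian = prob_space M for M :: "'w measure" +
  fixes z :: "'a::euclidean_space" and B :: "real \<Rightarrow> 'w \<Rightarrow> 'a"
  assumes bm: "brownian_motion M z B"
begin

definition past :: "real \<Rightarrow> 'w measure" where
  "past t = rv_sigma (space M) B {0..t}"

text \<open>Generated by increments after \<open>t\<close> rather than by positions, so that it is
  independent of \<open>past t\<close> outright, with no conditioning on the current
  position.\<close>

definition future :: "real \<Rightarrow> 'w measure" where
  "future t = rv_sigma (space M) (\<lambda>s \<omega>. B s \<omega> - B t \<omega>) {t..}"

lemma B_measurable: "0 \<le> t \<Longrightarrow> B t \<in> borel_measurable M"
  using bm by (simp add: brownian_motion_def)

lemma B_0: "\<omega> \<in> space M \<Longrightarrow> B 0 \<omega> = z"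
  using bm by (simp add: brownian_motion_def)

lemma B_continuous: "\<omega> \<in> space M \<Longrightarrow> continuous_on {0..} (\<lambda>t. B t \<omega>)"
  using bm by (simp add: brownian_motion_def)

lemma B_increment_distributed:
  "0 \<le> s \<Longrightarrow> s < t \<Longrightarrow> distributed M lborel (\<lambda>\<omega>. B t \<omega> - B s \<omega>) (\<lambda>x. ennreal (gaussian_density (t - s) x))"
  using bm by (simp add: brownian_motion_def)

lemma B_increments_indep:
  fixes k :: nat and t :: "nat \<Rightarrow> real"
  assumes "0 \<le> t 0" "\<And>i. i < k \<Longrightarrow> t i < t (Suc i)"
  shows "indep_vars (\<lambda>_. borel) (\<lambda>i \<omega>. B (t (Suc i)) \<omega> - B (t i) \<omega>) {..<k}"
  using bm assms unfolding brownian_motion_def by blast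

lemma space_past [simp]: "space (past t) = space M"
  and space_future [simp]: "space (future t) = space M"
  by (simp_all add: past_def future_def)

lemma past_measurable: "0 \<le> s \<Longrightarrow> s \<le> t \<Longrightarrow> B s \<in> borel_measurable (past t)"
  unfolding past_def by (rule measurable_rv_sigma) auto

lemma future_measurable: "t \<le> s \<Longrightarrow> (\<lambda>\<omega>. B s \<omega> - B t \<omega>) \<in> borel_measurable (future t)"
  unfolding future_def by (rule measurable_rv_sigma[where X = "\<lambda>s \<omega>. B s \<omega> - B t \<omega>"]) auto

lemma past_mono: "s \<le> t \<Longrightarrow> sets (past s) \<subseteq> sets (past t)"
  unfolding past_def by (rule sets_rv_sigma_mono) auto

lemma past_events: "sets (past t) \<subseteq> events"
  unfolding past_def by (rule sets_rv_sigma_le) (auto intro: B_measurable)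

lemma future_events: "0 \<le> t \<Longrightarrow> sets (future t) \<subseteq> events"
  unfolding future_def by (rule sets_rv_sigma_le) (auto intro!: borel_measurable_diff B_measurable)

text \<open>All times are merged into one sorted list. Positions up to \<open>t\<close> are sums of
  consecutive increments before the index of \<open>t\<close>, displacements from \<open>t\<close>
  on are sums of later ones, so the two events live on disjoint blocks of an independent
  family.\<close>

lemma indep_finite_past_future:
  assumes t: "0 \<le> t" and J: "finite J" "J \<subseteq> {0..t}" and K: "finite K" "K \<subseteq> {t..}"
    and E: "E \<in> sets (rv_sigma (space M) B J)"
    and G: "G \<in> sets (rv_sigma (space M) (\<lambda>s \<omega>. B s \<omega> - B t \<omega>) K)"
  shows "prob (E \<inter> G) = prob E * prob G"
proof -
  \<comment> \<open>The time \<open>0\<close> anchors the telescoping sums at the constant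
    \<open>z\<close>; the time \<open>t\<close> is the cut between the two blocks.\<close>
  define L where "L = sorted_list_of_set (J \<union> K \<union> {0, t})"
  define n where "n = length L - 1"
  define D where "D i \<omega> = B (L ! Suc i) \<omega> - B (L ! i) \<omega>" for i \<omega>
  have set_L: "set L = J \<union> K \<union> {0, t}"
    unfolding L_def by (rule set_sorted_list_of_set) (use J K in simp)
  have sorted: "sorted_wrt (<) L" by (simp add: L_def)
  have "length L > 0" using set_L by force
  then have len: "length L = Suc n" by (simp add: n_def)
  have mono: "L ! i < L ! j" if "i < j" "j \<le> n" for i j
    using sorted_wrt_nth_less[OF sorted that(1)] that(2) len by simp
  have idx: "\<exists>i\<le>n. s = L ! i" if "s \<in> J \<union> K \<union> {0, t}" for s
    using that unfolding set_L[symmetric] in_set_conv_nth len by (auto simp: less_Suc_eq_le)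
  have nonneg: "0 \<le> L ! i" if "i \<le> n" for i
  proof -
    have "L ! i \<in> J \<union> K \<union> {0, t}" using that len set_L[symmetric] by auto
    then show ?thesis using J K t by auto
  qed
  obtain i0 where "i0 \<le> n" "0 = L ! i0" using idx[of 0] by auto
  then have L0: "L ! 0 = 0"
    using mono[of 0 i0] nonneg[of 0] by (cases "i0 = 0") auto
  obtain p where p: "p \<le> n" "t = L ! p" using idx[of t] by auto
  have ind: "indep_vars (\<lambda>_. borel) D {..<n}"
    unfolding D_def[abs_def] by (rule B_increments_indep) (auto simp: L0 intro: mono)
  let ?U = "\<lambda>\<omega>. restrict (\<lambda>i. D i \<omega>) {..<p}" and ?V = "\<lambda>\<omega>. restrict (\<lambda>i. D i \<omega>) {p..<n}"
  let ?PU = "PiM {..<p} (\<lambda>_. borel :: 'a measure)" and ?PV = "PiM {p..<n} (\<lambda>_. borel :: 'a measure)"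
  have "indep_var ?PU ?U ?PV ?V"
    by (rule indep_var_restrict[OF ind]) (use p in auto)
  then have uv: "indep_set (sets (vimage_algebra (space M) ?U ?PU)) (sets (vimage_algebra (space M) ?V ?PV))"
    by (simp add: indep_var_eq sets_vimage_algebra)
  have DU: "D i \<in> borel_measurable (vimage_algebra (space M) ?U ?PU)" if "i < p" for i
  proof -
    have "(\<lambda>\<omega>. ?U \<omega> i) \<in> borel_measurable (vimage_algebra (space M) ?U ?PU)"
      by (rule measurable_compose[OF measurable_vimage_algebra1 measurable_component_singleton])
        (use that in \<open>auto simp: space_PiM split: if_splits\<close>)
    then show ?thesis using that by simp
  qed
  have DV: "D i \<in> borel_measurable (vimage_algebra (space M) ?V ?PV)" if "p \<le> i" "i < n" for i
  proof -
    have "(\<lambda>\<omega>. ?V \<omega> i) \<in> borel_measurable (vimage_algebra (space M) ?V ?PV)"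
      by (rule measurable_compose[OF measurable_vimage_algebra1 measurable_component_singleton])
        (use that in \<open>auto simp: space_PiM split: if_splits\<close>)
    then show ?thesis using that by simp
  qed
  have tele: "B (L ! j) \<omega> - B (L ! i) \<omega> = (\<Sum>l\<in>{i..<j}. D l \<omega>)" if "i \<le> j" for i j \<omega>
    using that unfolding D_def by (simp add: sum_Suc_diff'[of i j "\<lambda>l. B (L ! l) \<omega>"])
  have "sets (rv_sigma (space M) B J) \<subseteq> sets (vimage_algebra (space M) ?U ?PU)"
  proof (rule sets_rv_sigma_le)
    fix s assume s: "s \<in> J"
    then obtain i where i: "i \<le> n" "s = L ! i" using idx[of s] by auto
    have ip: "i \<le> p" using s J mono[of p i] i p by (cases "p < i") auto
    have "(\<lambda>\<omega>. z + (\<Sum>l\<in>{0..<i}. D l \<omega>)) \<in> borel_measurable (vimage_algebra (space M) ?U ?PU)"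
      using ip by (intro borel_measurable_add borel_measurable_sum DU) auto
    moreover have "B s \<omega> = z + (\<Sum>l\<in>{0..<i}. D l \<omega>)" if "\<omega> \<in> space M" for \<omega>
      using tele[of 0 i \<omega>] B_0[OF that] by (simp add: L0 i algebra_simps)
    ultimately show "B s \<in> borel_measurable (vimage_algebra (space M) ?U ?PU)"
      by (subst measurable_cong) auto
  qed simp
  moreover have "sets (rv_sigma (space M) (\<lambda>s \<omega>. B s \<omega> - B t \<omega>) K) \<subseteq> sets (vimage_algebra (space M) ?V ?PV)"
  proof (rule sets_rv_sigma_le)
    fix s assume s: "s \<in> K"
    then obtain i where i: "i \<le> n" "s = L ! i" using idx[of s] by auto
    have ip: "p \<le> i" using s K mono[of i p] i p by (cases "i < p") auto
    have "(\<lambda>\<omega>. \<Sum>l\<in>{p..<i}. D l \<omega>) \<in> borel_measurable (vimage_algebra (space M) ?V ?PV)"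
      using i by (intro borel_measurable_sum DV) auto
    then show "(\<lambda>\<omega>. B s \<omega> - B t \<omega>) \<in> borel_measurable (vimage_algebra (space M) ?V ?PV)"
      using tele[OF ip] by (simp add: i p)
  qed simp
  ultimately show ?thesis using indep_setD[OF uv] E G by blast
qed

text \<open>Finite subfamilies of times give intersection-stable generators on both sides, and the
  product formula extends from generators to the generated sigma-algebras.\<close>

lemma indep_past_future:
  assumes t: "0 \<le> t" and E: "E \<in> sets (past t)" and G: "G \<in> sets (future t)"
  shows "prob (E \<inter> G) = prob E * prob G"
proof -
  let ?\<E> = "\<Union>J\<in>{J. finite J \<and> J \<subseteq> {0..t}}. sets (rv_sigma (space M) B J)"
  let ?\<G> = "\<Union>J\<in>{J. finite J \<and> J \<subseteq> {t..}}. sets (rv_sigma (space M) (\<lambda>s \<omega>. B s \<omega> - B t \<omega>) J)"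
  have "?\<E> \<subseteq> events"
    using past_events[of t] sets_rv_sigma_mono[of _ "{0..t}" "space M" B] unfolding past_def by blast
  moreover have "?\<G> \<subseteq> events"
    using future_events[OF t] sets_rv_sigma_mono[of _ "{t..}" "space M" "\<lambda>s \<omega>. B s \<omega> - B t \<omega>"]
    unfolding future_def by blast
  moreover have "prob (a \<inter> b) = prob a * prob b" if "a \<in> ?\<E>" "b \<in> ?\<G>" for a b
    using that indep_finite_past_future[OF t] by blast
  ultimately have "indep_set ?\<E> ?\<G>"
    unfolding indep_sets2_eq by blast
  then have "indep_set (sets (past t)) (sets (future t))"
    unfolding past_def future_def rv_sigma_finite_generators(2)[of _ _ "{0..t}"]
      rv_sigma_finite_generators(2)[of _ _ "{t..}"]
    by (rule indep_set_sigma_sets) (rule rv_sigma_finite_generators(1))+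
  then show ?thesis using E G by (rule indep_setD)
qed

end

section \<open>Gaussian increments and maximal inequality\<close>

definition std_gaussian :: "'a::euclidean_space measure" where
  "std_gaussian = density lborel (\<lambda>x. ennreal (gaussian_density 1 x))"

lemma gaussian_density_measurable [measurable]:
  "(gaussian_density t :: 'a::euclidean_space \<Rightarrow> real) \<in> borel_measurable borel"
  unfolding gaussian_density_def by measurable

lemma gaussian_density_pos: "0 < t \<Longrightarrow> 0 < gaussian_density t x"
  unfolding gaussian_density_def by simp

lemma gaussian_density_scale:
  fixes y :: "'a::euclidean_space"
  assumes "0 < t"
  shows "sqrt t ^ DIM('a) * gaussian_density t (sqrt t *\<^sub>R y) = gaussian_density 1 y"
proof -
  have "sqrt t ^ DIM('a) = t powr (real DIM('a) / 2)"
    using assms by (simp add: powr_half_sqrt[symmetric] powr_realpow[symmetric] powr_powr)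
  moreover have "(2 * pi * t) powr (- (real DIM('a) / 2)) = (2 * pi) powr (- (real DIM('a) / 2)) * t powr (- (real DIM('a) / 2))"
    using assms by (simp add: powr_mult)
  moreover have "t powr (real DIM('a) / 2) * t powr (- (real DIM('a) / 2)) = 1"
    using assms by (simp add: powr_add[symmetric])
  ultimately show ?thesis
    using assms unfolding gaussian_density_def
    by (simp add: power_mult_distrib field_simps)
qed

lemma infdist_measurable: "(\<lambda>x. infdist x A) \<in> borel_measurable borel"
  by (intro borel_measurable_continuous_onI continuous_intros)

lemma sets_std_gaussian [simp, measurable_cong]: "sets std_gaussian = sets borel"
  and space_std_gaussian [simp]: "space std_gaussian = UNIV"
  by (simp_all add: std_gaussian_def)

text \<open>The density is strictly positive, so a Gaussian null set is Lebesgue null, which a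
  nonempty open set is not.\<close>

lemma std_gaussian_open_pos:
  fixes S :: "'a::euclidean_space set"
  assumes "open S" "S \<noteq> {}"
  shows "emeasure std_gaussian S > 0"
proof (rule ccontr)
  assume "\<not> emeasure std_gaussian S > 0"
  then have "S \<in> null_sets (std_gaussian :: 'a measure)" using assms(1) by auto
  then have "AE x in lborel. x \<in> S \<longrightarrow> ennreal (gaussian_density 1 x) = 0"
    unfolding std_gaussian_def by (subst (asm) null_sets_density_iff) auto
  then have "AE x in lborel. x \<notin> S"
    by eventually_elim (metis gaussian_density_pos ennreal_eq_0_iff not_le zero_less_one)
  then have "S \<in> null_sets lborel"
    using assms(1) by (simp add: AE_iff_null_sets)
  then have "negligible S"
    by (simp add: negligible_iff_null_sets null_sets_completionI)
  with assms open_not_negligible show False by blast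
qed

context brownian
begin

text \<open>Brownian scaling: one law serves all starting times and durations. Every constant below
  that is uniform in \<open>t\<close> and \<open>T\<close> originates here.\<close>

lemma increment_law:
  assumes "0 \<le> s" "0 < t"
  shows "distr M borel (\<lambda>\<omega>. (1 / sqrt t) *\<^sub>R (B (s + t) \<omega> - B s \<omega>)) = std_gaussian"
proof (rule measure_eqI)
  fix A assume "A \<in> sets (distr M borel (\<lambda>\<omega>. (1 / sqrt t) *\<^sub>R (B (s + t) \<omega> - B s \<omega>)))"
  then have A [measurable]: "A \<in> sets borel" by simp
  let ?X = "\<lambda>\<omega>. B (s + t) \<omega> - B s \<omega>"
  let ?f = "\<lambda>x. ennreal (gaussian_density t x)"
  have dist: "distributed M lborel ?X ?f"
    using B_increment_distributed[of s "s + t"] assms by simp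
  have [measurable]: "?X \<in> borel_measurable M"
    using assms by (intro borel_measurable_diff B_measurable) auto
  have lborel: "(lborel :: 'a measure) = density (distr lborel borel (\<lambda>x. sqrt t *\<^sub>R x)) (\<lambda>_. ennreal (sqrt t ^ DIM('a)))"
    using lborel_affine[of "sqrt t" "0::'a"] assms by simp
  have "emeasure (distr M borel (\<lambda>\<omega>. (1 / sqrt t) *\<^sub>R ?X \<omega>)) A
      = (\<integral>\<^sup>+\<omega>. indicator A ((1 / sqrt t) *\<^sub>R ?X \<omega>) \<partial>M)"
    by (subst nn_integral_indicator[symmetric], simp, subst nn_integral_distr) simp_all
  also have "\<dots> = (\<integral>\<^sup>+x. ?f x * indicator A ((1 / sqrt t) *\<^sub>R x) \<partial>lborel)"
    by (rule distributed_nn_integral[OF dist, symmetric]) simp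
  also have "\<dots> = (\<integral>\<^sup>+y. ennreal (sqrt t ^ DIM('a)) * (?f (sqrt t *\<^sub>R y) * indicator A ((1 / sqrt t) *\<^sub>R (sqrt t *\<^sub>R y))) \<partial>lborel)"
    by (subst lborel) (simp add: nn_integral_density nn_integral_distr)
  also have "\<dots> = (\<integral>\<^sup>+y. ennreal (gaussian_density 1 y) * indicator A y \<partial>lborel)"
  proof (rule nn_integral_cong)
    fix y :: 'a
    show "ennreal (sqrt t ^ DIM('a)) * (?f (sqrt t *\<^sub>R y) * indicator A ((1 / sqrt t) *\<^sub>R (sqrt t *\<^sub>R y)))
      = ennreal (gaussian_density 1 y) * indicator A y"
      using assms gaussian_density_scale[OF assms(2), of y]
      by (simp add: mult.assoc[symmetric] ennreal_mult'[symmetric])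
  qed
  also have "\<dots> = emeasure std_gaussian A"
    by (simp add: std_gaussian_def emeasure_density)
  finally show "emeasure (distr M borel (\<lambda>\<omega>. (1 / sqrt t) *\<^sub>R ?X \<omega>)) A = emeasure std_gaussian A" .
qed simp

lemma prob_increment:
  assumes "0 \<le> s" "0 < t" and S [measurable]: "S \<in> sets borel"
  shows "prob {\<omega>\<in>space M. (1 / sqrt t) *\<^sub>R (B (s + t) \<omega> - B s \<omega>) \<in> S} = measure std_gaussian S"
proof -
  have [measurable]: "(\<lambda>\<omega>. B (s + t) \<omega> - B s \<omega>) \<in> borel_measurable M"
    using assms by (intro borel_measurable_diff B_measurable) auto
  show ?thesis
    unfolding increment_law[OF assms(1,2), symmetric]
    by (subst measure_distr) (auto intro!: arg_cong[where f = prob])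
qed

text \<open>Total mass one is read off from the law of \<open>B 1 - B 0\<close> instead of a
  Gaussian integral, which is why the fact sits in the Brownian locale.\<close>

lemma prob_space_std_gaussian: "prob_space (std_gaussian :: 'a measure)"
proof -
  have "(\<lambda>\<omega>. (1 / sqrt 1) *\<^sub>R (B (0 + 1) \<omega> - B 0 \<omega>)) \<in> borel_measurable M"
    by (intro borel_measurable_scaleR borel_measurable_diff B_measurable) auto
  then show ?thesis
    unfolding increment_law[of 0 1, simplified, symmetric] by (intro prob_space_distr) simp
qed

lemma std_gaussian_tail:
  assumes "0 < \<epsilon>"
  obtains K where "0 < K" "measure (std_gaussian :: 'a measure) {y. norm y > K} < \<epsilon>"
proof -
  interpret G: prob_space "std_gaussian :: 'a measure" by (rule prob_space_std_gaussian)
  have "(\<lambda>n. measure (std_gaussian :: 'a measure) {y. norm y > real n})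
      \<longlonglongrightarrow> measure (std_gaussian :: 'a measure) (\<Inter>n. {y. norm y > real n})"
    by (rule G.finite_Lim_measure_decseq) (auto simp: decseq_def)
  moreover have "y \<notin> (\<Inter>n. {y::'a. norm y > real n})" for y
  proof -
    obtain n where "norm y < real n" using reals_Archimedean2 by blast
    then show ?thesis by (auto intro!: exI[of _ n])
  qed
  then have "(\<Inter>n. {y::'a. norm y > real n}) = {}" by blast
  ultimately have "(\<lambda>n. measure (std_gaussian :: 'a measure) {y. norm y > real n}) \<longlonglongrightarrow> 0"
    by simp
  from order_tendstoD(2)[OF this assms]
  obtain N where N: "\<And>n. n \<ge> N \<Longrightarrow> measure (std_gaussian :: 'a measure) {y. norm y > real n} < \<epsilon>"
    unfolding eventually_sequentially by auto
  show thesis by (rule that[of "real (Suc N)"]) (use N[of "Suc N"] in auto)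
qed

text \<open>Discrete substitute for the strong Markov property: \<open>E t\<close> says that the stopping condition holds
  at time \<open>t\<close>, and the events are made disjoint according to the first such time.\<close>

lemma prob_UN_finite_indep:
  assumes "finite J" "J \<subseteq> {0..}" "0 \<le> c"
    and "\<And>t. t \<in> J \<Longrightarrow> E t \<in> sets (past t)"
    and "\<And>t. t \<in> J \<Longrightarrow> G t \<in> sets (future t)"
    and "\<And>t. t \<in> J \<Longrightarrow> c \<le> prob (G t)"
  shows "c * prob (\<Union>t\<in>J. E t) \<le> prob (\<Union>t\<in>J. E t \<inter> G t)"
  using assms
proof (induction J rule: finite_linorder_max_induct)
  case empty
  then show ?case by simp
next
  case (insert m J)
  let ?U = "\<Union>t\<in>J. E t" and ?W = "\<Union>t\<in>J. E t \<inter> G t"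
  have m: "0 \<le> m" using insert.prems by auto
  have E: "E t \<in> sets (past m)" if "t \<in> insert m J" for t
    using insert.prems(3)[OF that] insert.hyps(2) past_mono[of t m] that by (auto simp: less_imp_le)
  have Ee: "E t \<in> events" if "t \<in> insert m J" for t using E[OF that] past_events by blast
  have Ge: "G t \<in> events" if "t \<in> insert m J" for t
    using insert.prems(1,4) future_events[of t] that by fastforce
  have U: "?U \<in> sets (past m)" using E insert.hyps(1) by (intro sets.finite_UN) auto
  then have Ue: "?U \<in> events" using past_events by blast
  have We: "?W \<in> events" using Ee Ge insert.hyps(1) by (intro sets.finite_UN) auto
  \<comment> \<open>The induction adds a maximal time \<open>m\<close>, so \<open>E m - ?U\<close>,
    the event that \<open>m\<close> is the first time, belongs to \<open>past m\<close> and is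
    independent of \<open>G m\<close>.\<close>
  have D: "E m - ?U \<in> sets (past m)" using E U by blast
  then have De: "E m - ?U \<in> events" using past_events by blast
  have "c * prob (\<Union>t\<in>insert m J. E t) = c * prob (?U \<union> (E m - ?U))"
    by (rule arg_cong[where f = "\<lambda>X. c * prob X"]) auto
  also have "\<dots> = c * prob ?U + c * prob (E m - ?U)"
    using Ue De by (subst finite_measure_Union) (auto simp: algebra_simps)
  also have "\<dots> \<le> prob ?W + prob (E m - ?U) * prob (G m)"
    using insert.IH insert.prems by (intro add_mono) (auto simp: mult.commute[of c] intro!: mult_left_mono)
  also have "\<dots> = prob ?W + prob ((E m - ?U) \<inter> G m)"
    using indep_past_future[OF m D, of "G m"] insert.prems(4) by simp
  also have "\<dots> = prob (?W \<union> ((E m - ?U) \<inter> G m))"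
    using We De Ge by (intro finite_measure_Union[symmetric]) auto
  also have "\<dots> \<le> prob (\<Union>t\<in>insert m J. E t \<inter> G t)"
    using Ee Ge insert.hyps(1) by (intro finite_measure_mono sets.finite_UN) auto
  finally show ?case .
qed

text \<open>A dense set of times need not contain a first one at which the condition holds. Finite
  exhaustions of \<open>J\<close> satisfy the bound with the same \<open>c\<close>, and continuity
  from below passes to the union.\<close>

lemma prob_UN_countable_indep:
  assumes J: "countable J" "J \<subseteq> {0..}" and c: "0 \<le> c"
    and E: "\<And>t. t \<in> J \<Longrightarrow> E t \<in> sets (past t)"
    and G: "\<And>t. t \<in> J \<Longrightarrow> G t \<in> sets (future t)"
    and cG: "\<And>t. t \<in> J \<Longrightarrow> c \<le> prob (G t)"
  shows "c * prob (\<Union>t\<in>J. E t) \<le> prob (\<Union>t\<in>J. E t \<inter> G t)"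
proof (cases "J = {}")
  case False
  define F where "F n = from_nat_into J ` {..n::nat}" for n
  have F: "finite (F n)" "F n \<subseteq> J" for n
    unfolding F_def using from_nat_into[OF False] by auto
  have "(\<Union>n. F n) = range (from_nat_into J)" unfolding F_def by blast
  then have UF: "(\<Union>n. F n) = J" using range_from_nat_into[OF False J(1)] by simp
  have Ee: "E t \<in> events" if "t \<in> J" for t using E[OF that] past_events by blast
  have Ge: "G t \<in> events" if "t \<in> J" for t using G[OF that] future_events[of t] J that by auto
  have "(\<lambda>n. c * prob (\<Union>t\<in>F n. E t)) \<longlonglongrightarrow> c * prob (\<Union>n. \<Union>t\<in>F n. E t)"
    using F Ee
    by (intro tendsto_mult_left finite_Lim_measure_incseq incseq_SucI)
      (auto simp: F_def atMost_Suc intro!: sets.finite_UN)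
  moreover have "(\<Union>n. \<Union>t\<in>F n. E t) = (\<Union>t\<in>J. E t)" using UF by auto
  moreover have "c * prob (\<Union>t\<in>F n. E t) \<le> prob (\<Union>t\<in>J. E t \<inter> G t)" for n
  proof -
    have "c * prob (\<Union>t\<in>F n. E t) \<le> prob (\<Union>t\<in>F n. E t \<inter> G t)"
      using F[of n] J c E G cG by (intro prob_UN_finite_indep) auto
    also have "\<dots> \<le> prob (\<Union>t\<in>J. E t \<inter> G t)"
      using F[of n] J Ee Ge by (intro finite_measure_mono) (auto intro!: sets.countable_UN')
    finally show ?thesis .
  qed
  ultimately show ?thesis
    by (intro LIMSEQ_le_const2) auto
qed simp

section \<open>Displacement over a time window\<close>

definition small_increments :: "real \<Rightarrow> real \<Rightarrow> real \<Rightarrow> 'w set" where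
  "small_increments t T r = {\<omega>\<in>space M. \<forall>s\<in>{t..t+T}. norm (B s \<omega> - B t \<omega>) \<le> r}"

text \<open>By path continuity a closed condition on a dense set of times extends to the whole
  window; this is what makes the event measurable.\<close>

lemma small_increments_countable:
  assumes "0 \<le> t" "C \<subseteq> {t..t+T}" "{t..t+T} \<subseteq> closure C"
  shows "small_increments t T r = {\<omega>\<in>space M. \<forall>s\<in>C. norm (B s \<omega> - B t \<omega>) \<le> r}"
proof -
  have "norm (B s \<omega> - B t \<omega>) \<le> r"
    if \<omega>: "\<omega> \<in> space M" and C: "\<forall>s\<in>C. norm (B s \<omega> - B t \<omega>) \<le> r" and s: "s \<in> {t..t+T}" for \<omega> s
  proof (rule continuous_le_on_closure[of C "\<lambda>s. norm (B s \<omega> - B t \<omega>)"])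
    have "closure C \<subseteq> {t..t+T}" using assms(2) by (intro closure_minimal) auto
    then show "continuous_on (closure C) (\<lambda>s. norm (B s \<omega> - B t \<omega>))"
      using assms(1) by (intro continuous_intros continuous_on_subset[OF B_continuous[OF \<omega>]]) auto
  qed (use C s assms(3) in auto)
  then show ?thesis using assms(2) unfolding small_increments_def by blast
qed

lemma small_increments_future:
  assumes "0 \<le> t"
  shows "small_increments t T r \<in> sets (future t)"
proof -
  obtain C where C: "countable C" "C \<subseteq> {t..t+T}" "{t..t+T} \<subseteq> closure C"
    by (rule separable)
  have "(\<Inter>s\<in>C. {\<omega>\<in>space (future t). norm (B s \<omega> - B t \<omega>) \<le> r}) \<inter> space (future t) \<in> sets (future t)"
  proof (cases "C = {}")
    case False
    then show ?thesis
      using C by (intro sets.Int sets.countable_INT' sets.top image_subsetI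
        borel_measurable_le measurable_compose[OF _ borel_measurable_norm] future_measurable borel_measurable_const) auto
  next
    case True
    then show ?thesis using sets.top[of "future t"] by simp
  qed
  also have "(\<Inter>s\<in>C. {\<omega>\<in>space (future t). norm (B s \<omega> - B t \<omega>) \<le> r}) \<inter> space (future t) = small_increments t T r"
    unfolding small_increments_countable[OF assms C(2,3)] by auto
  finally show ?thesis .
qed

text \<open>Ottaviani's argument: once the path is at distance more than twice \<open>K * sqrt T\<close>, it is
  still at distance more than \<open>K * sqrt T\<close> at time \<open>t + T\<close> with probability at least \<open>1/2\<close>.\<close>

lemma prob_large_increments_le:
  assumes t: "0 \<le> t" "0 < T" and K: "0 < K" "measure (std_gaussian :: 'a measure) {y. norm y > K} \<le> 1 / 2"
  shows "prob (space M - small_increments t T (2 * (K * sqrt T)))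
    \<le> 2 * measure (std_gaussian :: 'a measure) {y. norm y > K}"
proof -
  interpret G: prob_space "std_gaussian :: 'a measure" by (rule prob_space_std_gaussian)
  obtain C where C: "countable C" "C \<subseteq> {t..t+T}" "{t..t+T} \<subseteq> closure C"
    by (rule separable)
  let ?h = "K * sqrt T"
  \<comment> \<open>\<open>E s\<close> puts the path beyond \<open>2 * ?h\<close> at time
    \<open>s\<close>, and \<open>H s\<close> limits the remaining displacement up to
    \<open>t + T\<close> to \<open>?h\<close>. Together they leave the endpoint beyond
    \<open>?h\<close>, an event with a plain Gaussian tail bound.\<close>
  define E where "E s = {\<omega>\<in>space (past s). 2 * ?h < norm (B s \<omega> - B t \<omega>)}" for s
  define H where "H s = {\<omega>\<in>space (future s). norm (B (t + T) \<omega> - B s \<omega>) \<le> ?h}" for s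
  have E: "E s \<in> sets (past s)" if "s \<in> C" for s
    unfolding E_def using that C(2) t
    by (intro borel_measurable_less measurable_compose[OF _ borel_measurable_norm] borel_measurable_diff past_measurable) auto
  have H: "H s \<in> sets (future s)" if "s \<in> C" for s
    unfolding H_def using that C(2) t
    by (intro borel_measurable_le measurable_compose[OF _ borel_measurable_norm] future_measurable) auto
  have tail: "prob {\<omega>\<in>space M. norm (B (u + v) \<omega> - B u \<omega>) > ?h} \<le> measure (std_gaussian :: 'a measure) {y. norm y > K}"
    if "0 \<le> u" "0 < v" "v \<le> T" for u v
  proof -
    have le: "K * sqrt v \<le> ?h" using that K by (intro mult_left_mono) auto
    have "prob {\<omega>\<in>space M. norm (B (u + v) \<omega> - B u \<omega>) > ?h}
      \<le> prob {\<omega>\<in>space M. (1 / sqrt v) *\<^sub>R (B (u + v) \<omega> - B u \<omega>) \<in> {y. norm y > K}}"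
    proof (rule finite_measure_mono)
      show "{\<omega>\<in>space M. norm (B (u + v) \<omega> - B u \<omega>) > ?h}
        \<subseteq> {\<omega>\<in>space M. (1 / sqrt v) *\<^sub>R (B (u + v) \<omega> - B u \<omega>) \<in> {y. norm y > K}}"
        using that
        by (auto dest: le_less_trans[OF le] simp: scaleR_diff_right[symmetric] pos_less_divide_eq simp del: scaleR_diff_right)
      have [measurable]: "(\<lambda>\<omega>. B (u + v) \<omega> - B u \<omega>) \<in> borel_measurable M"
        using that by (intro borel_measurable_diff B_measurable) auto
      show "{\<omega>\<in>space M. (1 / sqrt v) *\<^sub>R (B (u + v) \<omega> - B u \<omega>) \<in> {y. norm y > K}} \<in> events"
        by measurable
    qed
    also have "\<dots> = measure (std_gaussian :: 'a measure) {y. norm y > K}"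
      using that by (intro prob_increment) auto
    finally show ?thesis .
  qed
  have halfH: "1 / 2 \<le> prob (H s)" if s: "s \<in> C" for s
  \<comment> \<open>At the endpoint no increment of positive duration remains, so the tail bound
    does not apply, but \<open>H s\<close> is the whole space.\<close>
  proof (cases "s = t + T")
    case True
    then have "H s = space M" using K t unfolding H_def by auto
    then show ?thesis by (simp add: prob_space)
  next
    case False
    have "space M - H s = {\<omega>\<in>space M. norm (B (s + (t + T - s)) \<omega> - B s \<omega>) > ?h}"
      unfolding H_def by auto
    then have "prob (space M - H s) \<le> 1 / 2"
      using tail[of s "t + T - s"] False s C(2) t K(2) by fastforce
    moreover have "0 \<le> s" using s C(2) t by auto
    then have "H s \<in> events" using H[OF s] future_events by blast
    ultimately show ?thesis by (simp add: prob_compl)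
  qed
  have "1 / 2 * prob (\<Union>s\<in>C. E s) \<le> prob (\<Union>s\<in>C. E s \<inter> H s)"
    using C t E H halfH by (intro prob_UN_countable_indep) auto
  also have "\<dots> \<le> prob {\<omega>\<in>space M. norm (B (t + T) \<omega> - B t \<omega>) > ?h}"
  proof (rule finite_measure_mono)
    show "(\<Union>s\<in>C. E s \<inter> H s) \<subseteq> {\<omega>\<in>space M. norm (B (t + T) \<omega> - B t \<omega>) > ?h}"
    proof
      fix \<omega> assume "\<omega> \<in> (\<Union>s\<in>C. E s \<inter> H s)"
      then obtain s where "\<omega> \<in> space M" and
        s: "2 * ?h < norm (B s \<omega> - B t \<omega>)" "norm (B (t + T) \<omega> - B s \<omega>) \<le> ?h"
        unfolding E_def H_def by auto
      moreover have "norm (B s \<omega> - B t \<omega>) \<le> norm (B (t + T) \<omega> - B t \<omega>) + norm (B (t + T) \<omega> - B s \<omega>)"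
        using norm_triangle_ineq4[of "B (t + T) \<omega> - B t \<omega>" "B (t + T) \<omega> - B s \<omega>"] by simp
      ultimately show "\<omega> \<in> {\<omega>\<in>space M. norm (B (t + T) \<omega> - B t \<omega>) > ?h}" by auto
    qed
    show "{\<omega>\<in>space M. norm (B (t + T) \<omega> - B t \<omega>) > ?h} \<in> events"
      using t by (intro borel_measurable_less measurable_compose[OF _ borel_measurable_norm] borel_measurable_diff B_measurable) auto
  qed
  also have "\<dots> \<le> measure (std_gaussian :: 'a measure) {y. norm y > K}"
    using tail[of t T] t by simp
  finally have "prob (\<Union>s\<in>C. E s) \<le> 2 * measure (std_gaussian :: 'a measure) {y. norm y > K}" by simp
  moreover have "(\<Union>s\<in>C. E s) = space M - small_increments t T (2 * ?h)"
    unfolding small_increments_countable[OF t(1) C(2,3)] E_def by auto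
  ultimately show ?thesis by simp
qed

lemma prob_small_increments_ge:
  assumes "0 < \<epsilon>"
  obtains K where "0 < K" "\<And>t T. 0 \<le> t \<Longrightarrow> 0 < T \<Longrightarrow> 1 - \<epsilon> \<le> prob (small_increments t T (K * sqrt T))"
proof -
  \<comment> \<open>The cutoff \<open>1/2\<close> licenses the maximal inequality, and
    \<open>\<epsilon>/2\<close> pays for its factor \<open>2\<close>.\<close>
  obtain K where K: "0 < K" "measure (std_gaussian :: 'a measure) {y. norm y > K} < min (1/2) (\<epsilon>/2)"
    by (rule std_gaussian_tail[of "min (1/2) (\<epsilon>/2)"]) (use assms in auto)
  have "1 - \<epsilon> \<le> prob (small_increments t T (2 * K * sqrt T))" if "0 \<le> t" "0 < T" for t T
    using prob_large_increments_le[OF that K(1)] K(2) that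
      prob_compl[of "small_increments t T (2 * (K * sqrt T))"]
      small_increments_future[of t T "2 * (K * sqrt T)"] future_events[of t]
    by (auto simp: mult.assoc subset_iff)
  then show thesis using K(1) by (intro that[of "2 * K"]) auto
qed

text \<open>This prescribes the final increment and at the same time confines the path meanwhile:
  \<open>K\<close> is taken so large that a large excursion costs at most half of the smallest
  probability of an \<open>S i\<close>. Scaling makes \<open>p\<close> and \<open>K\<close>
  independent of \<open>t\<close> and \<open>T\<close>.\<close>

lemma prob_directed_small_increments:
  fixes S :: "'i \<Rightarrow> 'a set"
  assumes "finite I" "\<And>i. i \<in> I \<Longrightarrow> open (S i)" "\<And>i. i \<in> I \<Longrightarrow> S i \<noteq> {}"
  obtains p K where "0 < p" "0 < K"
    "\<And>i t T. i \<in> I \<Longrightarrow> 0 \<le> t \<Longrightarrow> 0 < T \<Longrightarrow>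
      p \<le> prob ({\<omega>\<in>space M. (1 / sqrt T) *\<^sub>R (B (t + T) \<omega> - B t \<omega>) \<in> S i} \<inter> small_increments t T (K * sqrt T))"
proof -
  interpret G: prob_space "std_gaussian :: 'a measure" by (rule prob_space_std_gaussian)
  \<comment> \<open>The inserted \<open>1\<close> keeps the minimum defined when \<open>I\<close> is
    empty.\<close>
  define q where "q = Min (insert 1 ((\<lambda>i. measure (std_gaussian :: 'a measure) (S i)) ` I))"
  have "0 < measure (std_gaussian :: 'a measure) (S i)" if "i \<in> I" for i
    using std_gaussian_open_pos[OF assms(2)[OF that] assms(3)[OF that]] by (simp add: G.emeasure_eq_measure)
  then have q: "0 < q" unfolding q_def using assms(1) by (subst Min_gr_iff) auto
  have qS: "q \<le> measure std_gaussian (S i)" if "i \<in> I" for i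
    unfolding q_def using assms(1) that by (intro Min_le) auto
  obtain K where K: "0 < K" "\<And>t T. 0 \<le> t \<Longrightarrow> 0 < T \<Longrightarrow> 1 - q / 2 \<le> prob (small_increments t T (K * sqrt T))"
    using prob_small_increments_ge[of "q / 2"] q by auto
  have "q / 2 \<le> prob ({\<omega>\<in>space M. (1 / sqrt T) *\<^sub>R (B (t + T) \<omega> - B t \<omega>) \<in> S i} \<inter> small_increments t T (K * sqrt T))"
    (is "_ \<le> prob (?D \<inter> ?L)")
    if i: "i \<in> I" and t: "0 \<le> t" "0 < T" for i t T
  proof -
    have "S i \<in> sets borel" using assms(2)[OF i] by simp
    have [measurable]: "(\<lambda>\<omega>. B (t + T) \<omega> - B t \<omega>) \<in> borel_measurable M"
      using t by (intro borel_measurable_diff B_measurable) auto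
    have D: "?D \<in> events" using \<open>S i \<in> sets borel\<close> by measurable
    have L: "?L \<in> events" using small_increments_future future_events t by blast
    have "prob ?D \<le> prob ((?D \<inter> ?L) \<union> (space M - ?L))"
      using D L by (intro finite_measure_mono) auto
    also have "\<dots> \<le> prob (?D \<inter> ?L) + prob (space M - ?L)"
      using D L by (intro measure_Un_le) auto
    finally show ?thesis
      using qS[OF i] prob_increment[OF t \<open>S i \<in> sets borel\<close>] K(2)[OF t] prob_compl[OF L] by simp
  qed
  then show thesis using q K(1) by (intro that[of "q / 2" K]) auto
qed

section \<open>Remaining in an open set up to a given time\<close>

definition stays_in :: "'a set \<Rightarrow> real \<Rightarrow> 'w set" where
  "stays_in D t = {\<omega>\<in>space M. \<forall>s\<in>{0..t}. B s \<omega> \<in> D}"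

text \<open>Being in an open set at densely many times does not exclude touching the boundary in
  between. On a compact time interval, however, the distance to \<open>- D\<close> has a positive
  minimum, so staying inside is a countable union of the closed conditions that this distance is at
  least \<open>1 / (m + 1)\<close>, and each of these can be tested on a dense set. A nonempty
  \<open>- D\<close> is needed because \<open>infdist\<close> to the empty set is
  \<open>0\<close>.\<close>

lemma stays_in_past:
  assumes D: "open D" "D \<noteq> UNIV" and t: "0 \<le> t"
  shows "stays_in D t \<in> sets (past t)"
proof -
  obtain C where C: "countable C" "C \<subseteq> {0..t}" "{0..t} \<subseteq> closure C"
    by (rule separable)
  have clC: "closure C = {0..t}" using C by (intro antisym closure_minimal) auto
  have Cne: "C \<noteq> {}" using C(3) t by auto
  have ne: "- D \<noteq> {}" and cl: "closed (- D)" using D by auto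
  have "stays_in D t = (\<Union>m::nat. \<Inter>s\<in>C. {\<omega>\<in>space (past t). 1 / real (Suc m) \<le> infdist (B s \<omega>) (- D)})"
  proof (intro set_eqI iffI)
    fix \<omega> assume "\<omega> \<in> stays_in D t"
    then have \<omega>: "\<omega> \<in> space M" and in_D: "\<And>s. s \<in> {0..t} \<Longrightarrow> B s \<omega> \<in> D"
      unfolding stays_in_def by auto
    have "continuous_on {0..t} (\<lambda>s. infdist (B s \<omega>) (- D))"
      by (intro continuous_intros continuous_on_subset[OF B_continuous[OF \<omega>]]) auto
    from continuous_attains_inf[OF _ _ this] t
    obtain s0 where s0: "s0 \<in> {0..t}" "\<And>s. s \<in> {0..t} \<Longrightarrow> infdist (B s0 \<omega>) (- D) \<le> infdist (B s \<omega>) (- D)"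
      by auto
    have "0 < infdist (B s0 \<omega>) (- D)"
      using in_D[OF s0(1)] infdist_pos_not_in_closed[OF cl ne] by auto
    then obtain m :: nat where "1 / real (Suc m) < infdist (B s0 \<omega>) (- D)"
      using nat_approx_posE by blast
    then have "1 / real (Suc m) \<le> infdist (B s \<omega>) (- D)" if "s \<in> C" for s
      using s0(2)[of s] that C(2) by auto
    then show "\<omega> \<in> (\<Union>m::nat. \<Inter>s\<in>C. {\<omega>\<in>space (past t). 1 / real (Suc m) \<le> infdist (B s \<omega>) (- D)})"
      using \<omega> by auto
  next
    fix \<omega> assume "\<omega> \<in> (\<Union>m::nat. \<Inter>s\<in>C. {\<omega>\<in>space (past t). 1 / real (Suc m) \<le> infdist (B s \<omega>) (- D)})"
    then obtain m :: nat where \<omega>: "\<omega> \<in> space M"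
      and m: "\<And>s. s \<in> C \<Longrightarrow> 1 / real (Suc m) \<le> infdist (B s \<omega>) (- D)"
      using Cne by auto
    have "1 / real (Suc m) \<le> infdist (B s \<omega>) (- D)" if "s \<in> {0..t}" for s
    proof (rule continuous_ge_on_closure[of C "\<lambda>s. infdist (B s \<omega>) (- D)"])
      show "continuous_on (closure C) (\<lambda>s. infdist (B s \<omega>) (- D))"
        unfolding clC by (intro continuous_intros continuous_on_subset[OF B_continuous[OF \<omega>]]) auto
    qed (use that m clC in auto)
    then have "B s \<omega> \<in> D" if "s \<in> {0..t}" for s
      using that infdist_zero[of "B s \<omega>" "- D"] by fastforce
    then show "\<omega> \<in> stays_in D t" using \<omega> unfolding stays_in_def by auto
  qed
  also have "\<dots> \<in> sets (past t)"
    using C Cne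
    by (intro sets.countable_UN sets.countable_INT' image_subsetI borel_measurable_le
        borel_measurable_const measurable_compose[OF _ infdist_measurable] past_measurable) auto
  finally show ?thesis .
qed

end

section \<open>Exit from the parabolic region\<close>

context brownian
begin

text \<open>The times at which a continuous path is outside the open set \<open>D\<close> form a
  closed set, so their infimum is attained. Since \<open>z\<close> lies in \<open>D\<close>, time
  \<open>0\<close> is not among them, and the restriction to \<open>t > 0\<close> in
  \<open>exit_time\<close> changes nothing.\<close>

lemma exit_finite:
  assumes D: "open D" "z \<in> D" and \<omega>: "\<omega> \<in> space M" and ex: "\<exists>t>0. B t \<omega> \<notin> D"
  obtains \<tau> where "0 < \<tau>" "exit_position D B \<omega> = B \<tau> \<omega>" "B \<tau> \<omega> \<notin> D"
    "\<And>s. 0 \<le> s \<Longrightarrow> s < \<tau> \<Longrightarrow> B s \<omega> \<in> D"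
    "maximal_norm_before_exit D B \<omega> = (SUP s\<in>{0..<\<tau>}. norm (B s \<omega>))"
proof -
  define S where "S = {t \<in> {0..}. B t \<omega> \<in> - D}"
  have "closed S"
    unfolding S_def using D(1)
    by (intro continuous_closed_preimage[OF B_continuous[OF \<omega>], unfolded vimage_def Int_def mem_Collect_eq] ) auto
  moreover have ne: "S \<noteq> {}" using ex by (auto simp: S_def intro: less_imp_le)
  moreover have bdd: "bdd_below S" by (auto simp: S_def intro: bdd_belowI[of _ 0])
  ultimately have "Inf S \<in> S" by (intro closed_contains_Inf)
  then have inf: "0 \<le> Inf S" "B (Inf S) \<omega> \<notin> D" by (auto simp: S_def)
  have pos: "0 < Inf S"
    using inf D(2) B_0[OF \<omega>] by (cases "Inf S = 0") auto
  have before: "B s \<omega> \<in> D" if "0 \<le> s" "s < Inf S" for s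
    using cInf_lower[OF _ bdd, of s] that by (force simp: S_def)
  have "exit_time D B \<omega> = ereal (Inf S)"
    unfolding exit_time_def
  proof (intro antisym INF_greatest)
    show "(INF t\<in>{t. 0 < t \<and> B t \<omega> \<notin> D}. ereal t) \<le> ereal (Inf S)"
      using pos inf by (intro INF_lower) auto
    fix t assume "t \<in> {t. 0 < t \<and> B t \<omega> \<notin> D}"
    then show "ereal (Inf S) \<le> ereal t"
      using cInf_lower[OF _ bdd, of t] by (auto simp: S_def)
  qed
  moreover from this have "{t. 0 \<le> t \<and> ereal t < exit_time D B \<omega>} = {0..<Inf S}" by auto
  ultimately show thesis
    using pos inf before
    by (intro that[of "Inf S"]) (simp_all add: exit_position_def maximal_norm_before_exit_def)
qed

text \<open>The exit position is a limit of positions strictly before exit, and the norm is bounded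
  on the compact interval \<open>{0..\<tau>}\<close>, so the real supremum is a genuine one.\<close>

lemma norm_exit_position_le:
  assumes D: "open D" "z \<in> D" and \<omega>: "\<omega> \<in> space M" and ex: "\<exists>t>0. B t \<omega> \<notin> D"
  shows "norm (exit_position D B \<omega>) \<le> maximal_norm_before_exit D B \<omega>"
proof -
  obtain \<tau> where \<tau>: "0 < \<tau>" "exit_position D B \<omega> = B \<tau> \<omega>"
    "maximal_norm_before_exit D B \<omega> = (SUP s\<in>{0..<\<tau>}. norm (B s \<omega>))"
    by (rule exit_finite[OF assms])
  have cont: "continuous_on {0..\<tau>} (\<lambda>s. norm (B s \<omega>))"
    by (intro continuous_intros continuous_on_subset[OF B_continuous[OF \<omega>]]) auto
  have "bdd_above ((\<lambda>s. norm (B s \<omega>)) ` {0..\<tau>})"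
    by (intro bounded_imp_bdd_above compact_imp_bounded compact_continuous_image[OF cont]) simp
  then have bdd: "bdd_above ((\<lambda>s. norm (B s \<omega>)) ` {0..<\<tau>})"
    by (rule bdd_above_mono) auto
  have "norm (B \<tau> \<omega>) \<le> (SUP s\<in>{0..<\<tau>}. norm (B s \<omega>))"
  proof (rule continuous_le_on_closure[of "{0..<\<tau>}" "\<lambda>s. norm (B s \<omega>)"])
    show "norm (B s \<omega>) \<le> (SUP s\<in>{0..<\<tau>}. norm (B s \<omega>))" if "s \<in> {0..<\<tau>}" for s
      using bdd that by (intro cSUP_upper)
  qed (use \<tau> cont in auto)
  then show ?thesis by (simp add: \<tau>)
qed

end

section \<open>The parabolic region and almost sure exit\<close>

lemma open_parabolic_region: "open (parabolic_region A \<alpha> :: (real \<times> (real ^ 'm)) set)"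
proof -
  have "continuous_on {0<..} (\<lambda>x::real. A * x powr \<alpha>)"
    by (intro continuous_intros) auto
  then have "continuous_on ({0<..} \<times> UNIV) (\<lambda>p::real \<times> (real ^ 'm). A * fst p powr \<alpha> - norm (snd p))"
    by (intro continuous_intros) auto
  then have "open (({0<..} \<times> UNIV) \<inter> (\<lambda>p::real \<times> (real ^ 'm). A * fst p powr \<alpha> - norm (snd p)) -` {0<..})"
    by (rule continuous_open_preimage) (auto intro: open_Times)
  also have "({0<..} \<times> UNIV) \<inter> (\<lambda>p::real \<times> (real ^ 'm). A * fst p powr \<alpha> - norm (snd p)) -` {0<..}
      = parabolic_region A \<alpha>"
    by (auto simp: parabolic_region_def)
  finally show ?thesis .
qed

lemma parabolic_region_neq_UNIV: "parabolic_region A \<alpha> \<noteq> (UNIV :: (real \<times> (real ^ 'm)) set)"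
  by (auto simp: parabolic_region_def set_eq_iff intro!: exI[of _ 0])

locale parabola_brownian = brownian M z B
  for M :: "'w measure" and z :: "real \<times> (real ^ 'm)" and B +
  fixes A \<alpha> :: real
  assumes \<alpha>: "0 < \<alpha>" "\<alpha> < 1" and A: "0 < A" and z: "z \<in> parabolic_region A \<alpha>"
begin

abbreviation P :: "(real \<times> (real ^ 'm)) set" where
  "P \<equiv> parabolic_region A \<alpha>"

text \<open>Along this ray the lateral part grows like \<open>sqrt n\<close>, while the width
  allowed by the region grows only like its power \<open>\<alpha> < 1\<close>. The auxiliary
  \<open>q\<close> bounds the first coordinate by \<open>q * sqrt n\<close> for
  \<open>n \<ge> 1\<close>.\<close>

lemma eventually_outside:
  assumes "snd y \<noteq> 0"
  shows "eventually (\<lambda>n. z + sqrt (real n) *\<^sub>R y \<notin> P) sequentially"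
proof -
  define c q where "c = norm (snd y)" and "q = norm (fst z) + norm (fst y) + 1"
  have "0 < c" "0 < q" using assms by (auto simp: c_def q_def)
  then have "eventually (\<lambda>n. A * (q * sqrt (real n)) powr \<alpha> < c * sqrt (real n) - norm (snd z)) sequentially"
    using \<alpha> A by real_asymp
  then show ?thesis
    using eventually_ge_at_top[of 1]
  proof eventually_elim
    case (elim n)
    have n: "1 \<le> sqrt (real n)" using elim by simp
    show ?case
    proof
      assume "z + sqrt (real n) *\<^sub>R y \<in> P"
      then have pos: "0 < fst z + sqrt (real n) * fst y"
        and less: "norm (snd z + sqrt (real n) *\<^sub>R snd y) < A * (fst z + sqrt (real n) * fst y) powr \<alpha>"
        by (auto simp: parabolic_region_def case_prod_beta)
      have "fst z \<le> norm (fst z) * sqrt (real n)"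
        using n mult_left_mono[OF n, of "\<bar>fst z\<bar>"] by simp
      moreover have "sqrt (real n) * fst y \<le> norm (fst y) * sqrt (real n)"
        using n by (simp add: mult.commute mult_right_mono)
      ultimately have "fst z + sqrt (real n) * fst y \<le> q * sqrt (real n)"
        unfolding q_def distrib_right using n by linarith
      then have "A * (fst z + sqrt (real n) * fst y) powr \<alpha> \<le> A * (q * sqrt (real n)) powr \<alpha>"
        using pos A \<alpha> by (intro mult_left_mono powr_mono2) auto
      moreover have "c * sqrt (real n) - norm (snd z) \<le> norm (snd z + sqrt (real n) *\<^sub>R snd y)"
        using norm_diff_ineq[of "sqrt (real n) *\<^sub>R snd y" "snd z"] by (simp add: c_def add.commute mult.commute)
      ultimately show False using less elim by linarith
    qed
  qed
qed

text \<open>Staying forever is at most as likely as being in \<open>P\<close> at time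
  \<open>n\<close>, for each \<open>n \<ge> 1\<close>. By scaling the latter is the Gaussian measure
  of \<open>S n\<close>, which tends to \<open>0\<close> by dominated convergence, because almost
  every \<open>y\<close> has a nonzero lateral part. Laws at fixed times suffice.\<close>

lemma AE_exit: "AE \<omega> in M. \<exists>t>0. B t \<omega> \<notin> P"
proof -
  interpret G: prob_space "std_gaussian :: (real \<times> (real ^ 'm)) measure" by (rule prob_space_std_gaussian)
  define S where "S n = {y. z + sqrt (real n) *\<^sub>R y \<in> P}" for n
  have S [measurable]: "S n \<in> sets borel" for n
    unfolding S_def using open_vimage[OF open_parabolic_region, of "\<lambda>y. z + sqrt (real n) *\<^sub>R y" A \<alpha>]
    by (simp add: vimage_def continuous_intros)
  obtain j :: 'm where True by simp
  define e :: "real \<times> (real ^ 'm)" where "e = (0, axis j 1)"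
  have "negligible {y. e \<bullet> y = 0}"
    by (rule negligible_hyperplane) (auto simp: e_def axis_eq_0_iff zero_prod_def)
  moreover have "{y. e \<bullet> y = 0} \<in> sets lborel"
    by (simp add: closed_hyperplane borel_closed)
  ultimately have "{y. e \<bullet> y = 0} \<in> null_sets lborel"
    by (auto simp: negligible_iff_null_sets null_sets_completion_iff)
  then have "AE y in lborel. y \<notin> {y. e \<bullet> y = 0}"
    by (rule AE_not_in)
  then have "AE y in std_gaussian. y \<notin> {y. e \<bullet> y = 0}"
    unfolding std_gaussian_def by (subst AE_density) auto
  then have "AE y :: real \<times> (real ^ 'm) in std_gaussian. snd y \<noteq> 0"
    by (rule eventually_mono) (auto simp: e_def inner_prod_def)
  then have AE: "AE y in std_gaussian. (\<lambda>n. indicator (S n) y :: real) \<longlonglongrightarrow> 0"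
  proof eventually_elim
    case (elim y)
    have "eventually (\<lambda>n. indicator (S n) y = (0::real)) sequentially"
      using eventually_outside[OF elim] by eventually_elim (simp add: S_def)
    then show ?case by (rule tendsto_eventually)
  qed
  have "(\<lambda>n. \<integral>y. indicator (S n) y \<partial>std_gaussian) \<longlonglongrightarrow> (\<integral>(y::real \<times> (real ^ 'm)). (0::real) \<partial>std_gaussian)"
    by (rule integral_dominated_convergence[where w = "\<lambda>_. 1"]) (use AE in \<open>auto split: split_indicator\<close>)
  then have lim: "(\<lambda>n. measure std_gaussian (S n)) \<longlonglongrightarrow> 0" by simp
  let ?N = "\<Inter>n. stays_in P (real n)"
  have stays: "stays_in P (real n) \<in> events" for n
    using stays_in_past[OF open_parabolic_region parabolic_region_neq_UNIV, of "real n" A \<alpha>] past_events by auto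
  then have N: "?N \<in> events" by auto
  have "prob ?N \<le> measure std_gaussian (S n)" if "1 \<le> n" for n
  proof -
    have "prob ?N \<le> prob {\<omega>\<in>space M. (1 / sqrt (real n)) *\<^sub>R (B (0 + real n) \<omega> - B 0 \<omega>) \<in> S n}"
    proof (rule finite_measure_mono)
      have [measurable]: "(\<lambda>\<omega>. B (0 + real n) \<omega> - B 0 \<omega>) \<in> borel_measurable M"
        by (intro borel_measurable_diff B_measurable) auto
      show "{\<omega>\<in>space M. (1 / sqrt (real n)) *\<^sub>R (B (0 + real n) \<omega> - B 0 \<omega>) \<in> S n} \<in> events"
        by measurable
      show "?N \<subseteq> {\<omega>\<in>space M. (1 / sqrt (real n)) *\<^sub>R (B (0 + real n) \<omega> - B 0 \<omega>) \<in> S n}"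
        using that by (force simp: stays_in_def S_def B_0)
    qed
    also have "\<dots> = measure std_gaussian (S n)"
      using that by (intro prob_increment) auto
    finally show ?thesis .
  qed
  then have "prob ?N \<le> 0"
    by (intro LIMSEQ_le_const[OF lim] exI[of _ 1]) auto
  then have "prob ?N = 0" using measure_nonneg[of M ?N] by linarith
  then have "AE \<omega> in M. \<omega> \<notin> ?N"
    using N by (intro AE_not_in) (simp add: null_sets_def emeasure_eq_measure)
  with AE_space show ?thesis
  proof eventually_elim
    case (elim \<omega>)
    then obtain n s where ns: "0 \<le> s" "s \<le> real n" "B s \<omega> \<notin> P" by (auto simp: stays_in_def)
    then have "s \<noteq> 0" using B_0[of \<omega>] elim z by auto
    then show ?case using ns by (intro exI[of _ s]) auto
  qed
qed

end

section \<open>From a far interior position to a far exit\<close>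

context parabola_brownian
begin

lemma parabola_stays_past: "0 \<le> t \<Longrightarrow> stays_in P t \<in> sets (past t)"
  by (rule stays_in_past[OF open_parabolic_region parabolic_region_neq_UNIV])

text \<open>\<open>U\<close> contains the event that the path gets beyond distance \<open>r\<close>
  while inside, and on \<open>Q\<close> the exit is far out. Sandwiching by events avoids any
  measurability claim about the exit position or the maximum. The constant \<open>C\<close> is the
  displacement bound \<open>K\<close> of the small-increment estimate.\<close>

lemma exit_radius:
  "\<exists>c C r0. 0 < c \<and> 0 < C \<and> (\<forall>r\<ge>r0. \<exists>U\<in>events. \<exists>Q\<in>events.
      c * prob U \<le> prob Q
    \<and> (\<forall>\<omega>\<in>space M. \<forall>t\<ge>0. \<omega> \<in> stays_in P t \<longrightarrow> r < norm (B t \<omega>) \<longrightarrow> \<omega> \<in> U)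
    \<and> (\<forall>\<omega>\<in>Q. r - C * r powr \<alpha> \<le> norm (exit_position P B \<omega>)))"
proof -
  \<comment> \<open>With \<open>R = r powr \<alpha>\<close>, a lateral increment above
    \<open>8 * A * R\<close> forces exit: starting within distance \<open>2 * r\<close> and ending
    within \<open>3 * r\<close>, both inside the region, the lateral parts are at most
    \<open>2 * A * R\<close> and \<open>3 * A * R\<close>.\<close>
  define S where "S = {y::real \<times> (real ^ 'm). 8 * A < norm (snd y)}"
  obtain j :: 'm where True by simp
  have "open S"
    unfolding S_def by (intro open_Collect_less continuous_intros)
  moreover have "norm (axis j (8 * A + 1) :: real ^ 'm) = 8 * A + 1"
    unfolding norm_eq_sqrt_inner inner_axis_axis using A by simp
  then have "(0, axis j (8 * A + 1)) \<in> S"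
    unfolding S_def by simp
  ultimately have S: "open S" "S \<noteq> {}" by auto
  obtain c K where cK: "0 < c" "0 < K"
    "\<And>i t T. i \<in> {()} \<Longrightarrow> 0 \<le> t \<Longrightarrow> 0 < T \<Longrightarrow>
      c \<le> prob ({\<omega>\<in>space M. (1 / sqrt T) *\<^sub>R (B (t + T) \<omega> - B t \<omega>) \<in> S} \<inter> small_increments t T (K * sqrt T))"
    by (rule prob_directed_small_increments[of "{()}" "\<lambda>_. S"]) (use S in auto)
  obtain J where J: "countable J" "J \<subseteq> {0::real..}" "{0..} \<subseteq> closure J"
    by (rule separable)
  have "eventually (\<lambda>r. K * r powr \<alpha> \<le> r) at_top" using \<alpha> cK by real_asymp
  then obtain r1 where r1: "\<And>r. r \<ge> r1 \<Longrightarrow> K * r powr \<alpha> \<le> r"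
    unfolding eventually_at_top_linorder by auto
  \<comment> \<open>\<open>1 \<le> r\<close> gives \<open>r + 1 \<le> 2 * r\<close>, the bound on
    \<open>K * r powr \<alpha>\<close> keeps the endpoint within \<open>3 * r\<close>, and
    \<open>norm z \<le> r\<close> forces the path to cross the shell beyond
    \<open>r\<close>.\<close>
  define r0 where "r0 = max (max 1 r1) (norm z)"
  have "\<exists>U\<in>events. \<exists>Q\<in>events. c * prob U \<le> prob Q
    \<and> (\<forall>\<omega>\<in>space M. \<forall>t\<ge>0. \<omega> \<in> stays_in P t \<longrightarrow> r < norm (B t \<omega>) \<longrightarrow> \<omega> \<in> U)
    \<and> (\<forall>\<omega>\<in>Q. r - K * r powr \<alpha> \<le> norm (exit_position P B \<omega>))"
    if r: "r0 \<le> r" for r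
  proof -
    have r_ge: "1 \<le> r" "K * r powr \<alpha> \<le> r" "norm z \<le> r"
      using r r1[of r] by (auto simp: r0_def)
    define R where "R = r powr \<alpha>"
    have R: "0 < R" using r_ge by (simp add: R_def)
    have powR: "x powr \<alpha> \<le> q * R" if "0 < x" "x \<le> q * r" "1 \<le> q" for x q
    proof -
      have "x powr \<alpha> \<le> (q * r) powr \<alpha>" using that \<alpha> by (intro powr_mono2) auto
      also have "\<dots> = q powr \<alpha> * R" using that r_ge by (simp add: powr_mult R_def)
      also have "\<dots> \<le> q * R"
        using powr_mono[of \<alpha> 1 q] that \<alpha> R by (intro mult_right_mono) auto
      finally show ?thesis .
    qed
    \<comment> \<open>The upper bound \<open>r + 1\<close> ties the local width to \<open>r\<close>;
      a path that merely exceeds \<open>r\<close> may already be where the region is much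
      wider.\<close>
    define E where "E t = stays_in P t \<inter> ({\<omega>\<in>space (past t). r < norm (B t \<omega>)} \<inter> {\<omega>\<in>space (past t). norm (B t \<omega>) < r + 1})" for t
    define G where "G t = {\<omega>\<in>space M. (1 / sqrt (R\<^sup>2)) *\<^sub>R (B (t + R\<^sup>2) \<omega> - B t \<omega>) \<in> S} \<inter> small_increments t (R\<^sup>2) (K * sqrt (R\<^sup>2))" for t
    have Epast: "E t \<in> sets (past t)" if "t \<in> J" for t
      unfolding E_def using that J(2)
      by (intro sets.Int parabola_stays_past borel_measurable_less
          measurable_compose[OF _ borel_measurable_norm] past_measurable borel_measurable_const) auto
    have Gfut: "G t \<in> sets (future t)" if "t \<in> J" for t
    proof -
      have "(\<lambda>\<omega>. B (t + R\<^sup>2) \<omega> - B t \<omega>) \<in> borel_measurable (future t)"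
        by (rule future_measurable) auto
      then have "(\<lambda>\<omega>. (1 / sqrt (R\<^sup>2)) *\<^sub>R (B (t + R\<^sup>2) \<omega> - B t \<omega>)) -` S \<inter> space (future t) \<in> sets (future t)"
        by (rule measurable_sets[OF borel_measurable_scaleR[OF borel_measurable_const]]) (use S(1) in auto)
      also have "(\<lambda>\<omega>. (1 / sqrt (R\<^sup>2)) *\<^sub>R (B (t + R\<^sup>2) \<omega> - B t \<omega>)) -` S \<inter> space (future t)
        = {\<omega>\<in>space M. (1 / sqrt (R\<^sup>2)) *\<^sub>R (B (t + R\<^sup>2) \<omega> - B t \<omega>) \<in> S}" by auto
      finally show ?thesis
        unfolding G_def using that J(2) by (intro sets.Int small_increments_future) auto
    qed
    have Gprob: "c \<le> prob (G t)" if "t \<in> J" for t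
      unfolding G_def using that J(2) R by (intro cK(3)[of "()"]) auto
    let ?U = "\<Union>t\<in>J. E t" and ?Q = "\<Union>t\<in>J. E t \<inter> G t"
    have Ee: "E t \<in> events" if "t \<in> J" for t using Epast[OF that] past_events by blast
    have Ge: "G t \<in> events" if "t \<in> J" for t using Gfut[OF that] future_events[of t] that J(2) by auto
    have "c * prob ?U \<le> prob ?Q"
      using J cK(1) Epast Gfut Gprob by (intro prob_UN_countable_indep) auto
    moreover have "?U \<in> events" "?Q \<in> events"
      using J(1) Ee Ge by (auto intro!: sets.countable_UN')
    moreover have "\<omega> \<in> ?U"
      if \<omega>: "\<omega> \<in> space M" and t: "0 \<le> t" "\<omega> \<in> stays_in P t" "r < norm (B t \<omega>)" for \<omega> t
    proof -
      have cont: "continuous_on {0..} (\<lambda>s. norm (B s \<omega>))"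
        by (intro continuous_intros B_continuous[OF \<omega>])
      \<comment> \<open>A level strictly inside the shell. The path takes this value by the
        intermediate value theorem, and continuity leaves an interval just before that moment on
        which it stays in the open shell; \<open>J\<close> meets this interval.\<close>
      define v where "v = (r + min (norm (B t \<omega>)) (r + 1)) / 2"
      have v: "r < v" "v < r + 1" "v \<le> norm (B t \<omega>)" using t(3) by (auto simp: v_def min_def field_simps)
      have "\<exists>s\<ge>0. s \<le> t \<and> norm (B s \<omega>) = v"
        using v t B_0[OF \<omega>] r_ge by (intro IVT' continuous_on_subset[OF cont]) auto
      then obtain s where s: "0 \<le> s" "s \<le> t" "norm (B s \<omega>) = v" by auto
      have "s \<noteq> 0" using s(3) v B_0[OF \<omega>] r_ge by auto
      define \<epsilon> where "\<epsilon> = min (v - r) (r + 1 - v)"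
      have "0 < \<epsilon>" using v by (simp add: \<epsilon>_def)
      then obtain d where d: "0 < d" "\<And>u. 0 \<le> u \<Longrightarrow> \<bar>u - s\<bar> < d \<Longrightarrow> \<bar>norm (B u \<omega>) - v\<bar> < \<epsilon>"
        using cont s unfolding continuous_on_iff dist_real_def by fastforce
      \<comment> \<open>The dense time is sought strictly to the left of \<open>s\<close>, since
        staying in the region is known only up to \<open>t\<close>.\<close>
      define l where "l = max 0 (s - d)"
      have l: "0 \<le> l" "s - d \<le> l" "l < s" using d s \<open>s \<noteq> 0\<close> by (auto simp: l_def)
      then have "(l + s) / 2 \<in> closure J" using J(3) by auto
      moreover have "0 < (s - l) / 2" using l by simp
      ultimately obtain u where u: "u \<in> J" "\<bar>u - (l + s) / 2\<bar> < (s - l) / 2"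
        unfolding closure_approachable dist_real_def by blast
      then have "l < u" "u < s" by (simp_all add: abs_less_iff field_simps)
      then have us: "u < s" "\<bar>u - s\<bar> < d" using l by auto
      have u0: "0 \<le> u" using u J(2) by auto
      then have "r < norm (B u \<omega>)" "norm (B u \<omega>) < r + 1"
        using d(2)[OF u0 us(2)] unfolding \<epsilon>_def by auto
      then have "\<omega> \<in> E u"
        using u0 us s t(2) \<omega> unfolding E_def stays_in_def by auto
      then show ?thesis using u by blast
    qed
    moreover have "r - K * r powr \<alpha> \<le> norm (exit_position P B \<omega>)" if "\<omega> \<in> ?Q" for \<omega>
    proof -
      obtain t where t: "t \<in> J" "\<omega> \<in> E t" "\<omega> \<in> G t" using \<open>\<omega> \<in> ?Q\<close> by blast
      have t0: "0 \<le> t" using t(1) J(2) by auto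
      have \<omega>: "\<omega> \<in> space M" and stays: "\<And>s. 0 \<le> s \<Longrightarrow> s \<le> t \<Longrightarrow> B s \<omega> \<in> P"
        and rt: "r < norm (B t \<omega>)" "norm (B t \<omega>) < r + 1"
        using t(2) by (auto simp: E_def stays_in_def)
      let ?u = "t + R\<^sup>2"
      have inc: "8 * A < norm (snd ((1 / R) *\<^sub>R (B ?u \<omega> - B t \<omega>)))"
        and small: "\<And>s. t \<le> s \<Longrightarrow> s \<le> ?u \<Longrightarrow> norm (B s \<omega> - B t \<omega>) \<le> K * R"
        using t(3) R by (auto simp: G_def S_def small_increments_def)
      have inc: "8 * A * R < norm (snd (B ?u \<omega>) - snd (B t \<omega>))"
        using inc R by (simp add: pos_less_divide_eq scaleR_diff_right[symmetric] del: scaleR_diff_right)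
      have KR: "K * R \<le> r" using r_ge by (simp add: R_def)
      have out: "B ?u \<omega> \<notin> P"
      proof
        assume in_P: "B ?u \<omega> \<in> P"
        have "0 < fst (B t \<omega>)" "norm (snd (B t \<omega>)) < A * fst (B t \<omega>) powr \<alpha>"
          using stays[of t] t0 by (auto simp: parabolic_region_def case_prod_beta)
        moreover have "fst (B t \<omega>) \<le> 2 * r"
          using norm_fst_le[of "fst (B t \<omega>)" "snd (B t \<omega>)"] rt r_ge by simp
        ultimately have 1: "norm (snd (B t \<omega>)) \<le> A * (2 * R)"
          using powR[of "fst (B t \<omega>)" 2] A by (smt (verit) mult_left_mono)
        have "0 < fst (B ?u \<omega>)" "norm (snd (B ?u \<omega>)) < A * fst (B ?u \<omega>) powr \<alpha>"
          using in_P by (auto simp: parabolic_region_def case_prod_beta)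
        moreover have "norm (B ?u \<omega>) \<le> norm (B t \<omega>) + norm (B ?u \<omega> - B t \<omega>)"
          by (metis add.commute diff_add_cancel norm_triangle_ineq)
        then have "fst (B ?u \<omega>) \<le> 3 * r"
          using norm_fst_le[of "fst (B ?u \<omega>)" "snd (B ?u \<omega>)"] rt r_ge KR small[of ?u] by simp
        ultimately have 2: "norm (snd (B ?u \<omega>)) \<le> A * (3 * R)"
          using powR[of "fst (B ?u \<omega>)" 3] A by (smt (verit) mult_left_mono)
        have "0 < A * R" using A R by simp
        then show False
          using inc 1 2 norm_triangle_ineq4[of "snd (B ?u \<omega>)" "snd (B t \<omega>)"] by (simp add: mult.assoc)
      qed
      have ex: "\<exists>u>0. B u \<omega> \<notin> P" using out t0 R by (intro exI[of _ ?u]) (auto intro: add_nonneg_pos)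
      obtain \<tau> where \<tau>: "0 < \<tau>" "exit_position P B \<omega> = B \<tau> \<omega>" "B \<tau> \<omega> \<notin> P"
        "\<And>s. 0 \<le> s \<Longrightarrow> s < \<tau> \<Longrightarrow> B s \<omega> \<in> P"
        by (rule exit_finite[OF open_parabolic_region z \<omega> ex]) blast
      have "t \<le> \<tau>" using stays[of \<tau>] \<tau> by force
      moreover have "\<tau> \<le> ?u" using \<tau>(4)[of ?u] out t0 by force
      ultimately have "norm (B \<tau> \<omega> - B t \<omega>) \<le> K * R" by (rule small)
      moreover have "norm (B t \<omega>) \<le> norm (B \<tau> \<omega>) + norm (B \<tau> \<omega> - B t \<omega>)"
        using norm_triangle_ineq4[of "B \<tau> \<omega>" "B \<tau> \<omega> - B t \<omega>"] by simp
      ultimately show ?thesis using rt by (simp add: \<tau>(2) R_def)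
    qed
    ultimately show ?thesis by blast
  qed
  then show ?thesis using cK(1,2) by blast
qed

end

section \<open>Travelling far along the tube\<close>

text \<open>Combines \<open>ln (1 + u) \<ge> u / (1 + u)\<close> with
  \<open>exp x \<ge> 1 + x\<close>. It replaces Bernoulli's inequality, which points the other way
  for exponents below one.\<close>

lemma powr_increment_ge:
  fixes u \<beta> :: real
  assumes "0 < u" "0 < \<beta>"
  shows "1 + \<beta> * (u / (1 + u)) \<le> (1 + u) powr \<beta>"
proof -
  have "ln (1 / (1 + u)) \<le> 1 / (1 + u) - 1"
    by (rule ln_le_minus_one) (use assms in simp)
  then have "u / (1 + u) \<le> ln (1 + u)"
    using assms by (simp add: ln_div field_simps)
  then have "1 + \<beta> * (u / (1 + u)) \<le> 1 + \<beta> * ln (1 + u)"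
    using assms by (intro add_left_mono mult_left_mono) auto
  also have "\<dots> \<le> exp (\<beta> * ln (1 + u))" by (rule exp_ge_add_one_self)
  also have "\<dots> = (1 + u) powr \<beta>" using assms by (simp add: powr_def)
  finally show ?thesis .
qed

text \<open>Discrete form of the equation \<open>\<rho>' = \<theta> \<rho>^\<alpha>\<close>, along
  whose solutions \<open>\<rho>^(1-\<alpha>)\<close> grows linearly. Read backwards it counts steps:
  reaching \<open>\<rho>\<close> takes at most a multiple of \<open>\<rho>^(1-\<alpha>)\<close> of
  them.\<close>

lemma sublinear_recursion_growth:
  fixes \<rho> :: "nat \<Rightarrow> real"
  assumes \<alpha>: "0 < \<alpha>" "\<alpha> < 1" and \<theta>: "0 < \<theta>" and pos: "0 < \<rho> 0"
    and rec: "\<And>k. \<rho> (Suc k) = \<rho> k + \<theta> * \<rho> k powr \<alpha>"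
  obtains c where "0 < c" "\<And>k. c * real k \<le> \<rho> k powr (1 - \<alpha>)"
proof -
  define \<beta> where "\<beta> = 1 - \<alpha>"
  have \<beta>: "0 < \<beta>" using \<alpha> by (simp add: \<beta>_def)
  have ge: "\<rho> 0 \<le> \<rho> k" for k
  proof (induction k)
    case (Suc k)
    have "0 \<le> \<theta> * \<rho> k powr \<alpha>" using \<theta> by simp
    then show ?case using Suc rec[of k] by linarith
  qed simp
  \<comment> \<open>The relative increment, \<open>\<rho> (Suc k) = \<rho> k * (1 + u k)\<close>. It
    is largest at \<open>k = 0\<close>, which makes \<open>c\<close> uniform in
    \<open>k\<close>.\<close>
  define u where "u k = \<theta> * \<rho> k powr (- \<beta>)" for k
  define c where "c = \<beta> * \<theta> / (1 + u 0)"
  have u0: "0 < u k" for k using \<theta> ge[of k] pos by (simp add: u_def)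
  have c: "0 < c" using \<theta> \<beta> u0[of 0] by (simp add: c_def)
  have step: "\<rho> k powr \<beta> + c \<le> \<rho> (Suc k) powr \<beta>" for k
  proof -
    have \<rho>: "0 < \<rho> k" using ge[of k] pos by linarith
    have uk: "u k \<le> u 0"
      unfolding u_def using \<theta> \<beta> pos ge[of k] by (intro mult_left_mono powr_mono2') auto
    have "\<rho> k powr \<alpha> = \<rho> k powr (1 + - \<beta>)" by (simp add: \<beta>_def)
    also have "\<dots> = \<rho> k * \<rho> k powr (- \<beta>)" using \<rho> by (simp only: powr_add powr_one)
    finally have eq: "\<rho> (Suc k) = \<rho> k * (1 + u k)"
      unfolding rec u_def by (simp add: algebra_simps)
    have inv: "\<rho> k powr \<beta> * u k = \<theta>"
      using \<rho> by (simp add: u_def powr_minus field_simps)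
    have "c \<le> \<beta> * \<theta> / (1 + u k)"
      unfolding c_def using \<beta> \<theta> uk u0[of k] by (intro divide_left_mono) auto
    also have "\<dots> = \<rho> k powr \<beta> * (\<beta> * (u k / (1 + u k)))"
      by (simp add: inv[symmetric])
    finally have "\<rho> k powr \<beta> + c \<le> \<rho> k powr \<beta> * (1 + \<beta> * (u k / (1 + u k)))"
      by (simp add: distrib_left)
    also have "\<dots> \<le> \<rho> k powr \<beta> * (1 + u k) powr \<beta>"
      using powr_increment_ge[OF u0 \<beta>, of k] by (intro mult_left_mono) auto
    also have "\<dots> = \<rho> (Suc k) powr \<beta>"
      unfolding eq using \<rho> u0[of k] by (simp add: powr_mult)
    finally show ?thesis .
  qed
  have "c * real k \<le> \<rho> k powr \<beta>" for k
  proof (induction k)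
    case (Suc k)
    then show ?case using step[of k] by (simp add: algebra_simps)
  qed simp
  then show thesis using c by (intro that) (auto simp: \<beta>_def)
qed

context parabola_brownian
begin

text \<open>With \<open>R \<rho> = A * \<rho> powr \<alpha>\<close> and \<open>x = fst z\<close>,
  division by \<open>R \<rho>\<close> reduces everything to
  \<open>l + n * m < 1 - m * (R x / x)\<close>: the fraction \<open>l < 1\<close> of the width used
  by \<open>z\<close> does not grow with \<open>\<rho>\<close>, and \<open>R \<rho> / \<rho>\<close>
  decreases as \<open>\<alpha> < 1\<close>. In the factor \<open>CARD('m) + 1\<close>, the first
  summand allows \<open>m * R \<rho>\<close> in each lateral coordinate, the second is the
  displacement during one step.\<close>

lemma tube_room:
  obtains m where "0 < m"
    "\<And>\<rho>. fst z \<le> \<rho> \<Longrightarrow> 0 < \<rho> - m * (A * \<rho> powr \<alpha>)"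
    "\<And>\<rho>. fst z \<le> \<rho> \<Longrightarrow>
      norm (snd z) + (real CARD('m) + 1) * (m * (A * \<rho> powr \<alpha>)) < A * (\<rho> - m * (A * \<rho> powr \<alpha>)) powr \<alpha>"
proof -
  define x R where "x = fst z" and "R \<rho> = A * \<rho> powr \<alpha>" for \<rho>
  have x: "0 < x" and Yx: "norm (snd z) < R x"
    using z by (auto simp: x_def R_def parabolic_region_def case_prod_beta)
  define l where "l = norm (snd z) / R x"
  define n where "n = real CARD('m) + 1"
  \<comment> \<open>Uses up half of the margin:
    \<open>m * (n + R x / x) = (1 - l) / 2\<close>.\<close>
  define m where "m = (1 - l) / (2 * (n + R x / x))"
  have R: "0 < R \<rho>" if "0 < \<rho>" for \<rho> using that A by (simp add: R_def)
  have l: "l < 1" "0 \<le> l" using Yx R[OF x] by (simp_all add: l_def)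
  have n: "0 < n" by (simp add: n_def)
  have den: "0 < n + R x / x" using n R[OF x] x by (simp add: add_pos_pos)
  have m: "0 < m" using l den by (simp add: m_def)
  define w where "w = (1 - l) / 2"
  have w: "2 * w = 1 - l" "0 < w" using l by (simp_all add: w_def)
  have "m * (n + R x / x) = w"
    unfolding m_def w_def using den by (simp only: times_divide_eq_left) (simp add: divide_simps)
  then have "n * m + m * (R x / x) = w"
    by (simp only: distrib_left mult.commute[of n m])
  moreover have "l + q < 1 - r" if "q + r = w" for q r using that w by linarith
  ultimately have room: "l + n * m < 1 - m * (R x / x)" by blast
  have main: "0 < \<rho> - m * R \<rho> \<and> norm (snd z) + n * (m * R \<rho>) < A * (\<rho> - m * R \<rho>) powr \<alpha>"
    if "x \<le> \<rho>" for \<rho>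
  proof -
    have \<rho>: "0 < \<rho>" using that x by simp
    have ratio: "R s / s = A * s powr (\<alpha> - 1)" if "0 < s" for s
      using that by (simp add: R_def powr_diff)
    have "R \<rho> / \<rho> \<le> R x / x"
      unfolding ratio[OF \<rho>] ratio[OF x] using A \<alpha> x \<open>x \<le> \<rho>\<close> by (intro mult_left_mono powr_mono2') auto
    then have "m * (R \<rho> / \<rho>) \<le> m * (R x / x)" using m by (intro mult_left_mono) auto
    moreover define h where "h = m * (R \<rho> / \<rho>)"
    ultimately have h: "l + n * m < 1 - h" using room by linarith
    have h0: "0 < h" using m R[OF \<rho>] \<rho> by (simp add: h_def)
    have nm: "0 < n * m" using n m by simp
    have h1: "0 < 1 - h" "1 - h \<le> 1" using h h0 l nm by linarith+
    have eq: "\<rho> - m * R \<rho> = \<rho> * (1 - h)" using \<rho> by (simp add: h_def field_simps)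
    have "norm (snd z) = l * R x" using R[OF x] by (simp add: l_def)
    also have "\<dots> \<le> l * R \<rho>"
      unfolding R_def using l A \<alpha> x \<open>x \<le> \<rho>\<close> by (intro mult_left_mono powr_mono2) auto
    finally have "norm (snd z) + n * (m * R \<rho>) \<le> (l + n * m) * R \<rho>" by (simp add: algebra_simps)
    also have "\<dots> < (1 - h) * R \<rho>" using h R[OF \<rho>] by (intro mult_strict_right_mono)
    also have "\<dots> \<le> (1 - h) powr \<alpha> * R \<rho>"
      using powr_mono'[of \<alpha> 1 "1 - h"] h1 \<alpha> R[OF \<rho>] by (intro mult_right_mono) auto
    also have "\<dots> = A * (\<rho> - m * R \<rho>) powr \<alpha>"
      unfolding eq using \<rho> h1 by (simp add: R_def powr_mult)
    finally show ?thesis using eq \<rho> h1 by simp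
  qed
  show thesis
    by (rule that[OF m]) (use main in \<open>auto simp: x_def R_def n_def\<close>)
qed

text \<open>Each step of the chain lasts a multiple of the squared local width and advances the path by a fixed
  fraction of the width, while every coordinate of \<open>snd (B t \<omega>)\<close> moves against its current sign. Splitting
  by the sign pattern \<open>s\<close> makes the required increment event independent of the past.\<close>

lemma stay_far_prob:
  obtains p c where "0 < p" "0 < c"
    "\<And>k. \<exists>\<rho> t. \<exists>E\<in>events. 0 < \<rho> \<and> c * real k \<le> \<rho> powr (1 - \<alpha>) \<and> 0 \<le> t \<and> p ^ k \<le> prob E
      \<and> E \<subseteq> stays_in P t \<and> (\<forall>\<omega>\<in>E. \<rho> \<le> norm (B t \<omega>))"
proof -
  obtain m where m: "0 < m"
    "\<And>\<rho>. fst z \<le> \<rho> \<Longrightarrow> 0 < \<rho> - m * (A * \<rho> powr \<alpha>)"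
    "\<And>\<rho>. fst z \<le> \<rho> \<Longrightarrow>
      norm (snd z) + (real CARD('m) + 1) * (m * (A * \<rho> powr \<alpha>)) < A * (\<rho> - m * (A * \<rho> powr \<alpha>)) powr \<alpha>"
    by (rule tube_room) blast
  have x0: "0 < fst z" using z by (auto simp: parabolic_region_def case_prod_beta)
  \<comment> \<open>After rescaling, first coordinate above \<open>1\<close> means an advance of
    more than \<open>\<theta> * R k\<close>. The flag \<open>s j\<close> records that lateral
    coordinate \<open>j\<close> is nonnegative and hence has to decrease.\<close>
  define S :: "('m \<Rightarrow> bool) \<Rightarrow> (real \<times> (real ^ 'm)) set" where
    "S s = {y. 1 < fst y} \<inter> (\<Inter>j. {y. 0 < (if s j then - 1 else 1) * (snd y $ j)})" for s
  have S_open: "open (S s)" for s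
    unfolding S_def by (intro open_Int open_INT ballI finite[where 'a = 'm] open_Collect_less continuous_intros)
  have "(2, \<chi> j. if s j then - 1 else 1) \<in> S s" for s by (simp add: S_def)
  then have S_ne: "S s \<noteq> {}" for s by blast
  obtain p K where pK: "0 < p" "0 < K"
    "\<And>s t T. s \<in> UNIV \<Longrightarrow> 0 \<le> t \<Longrightarrow> 0 < T \<Longrightarrow>
      p \<le> prob ({\<omega>\<in>space M. (1 / sqrt T) *\<^sub>R (B (t + T) \<omega> - B t \<omega>) \<in> S s} \<inter> small_increments t T (K * sqrt T))"
    by (rule prob_directed_small_increments[of "UNIV :: ('m \<Rightarrow> bool) set" S]) (use S_open S_ne in auto)
  \<comment> \<open>For duration \<open>(\<theta> * R k)\<^sup>2\<close> the displacement bound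
    \<open>K * (\<theta> * R k)\<close> becomes \<open>m * R k\<close>, the room granted by
    \<open>tube_room\<close>.\<close>
  define \<theta> where "\<theta> = m / K"
  have \<theta>: "0 < \<theta>" using m(1) pK(2) by (simp add: \<theta>_def)
  define \<rho> where "\<rho> = rec_nat (fst z) (\<lambda>_ r. r + (\<theta> * A) * r powr \<alpha>)"
  have \<rho>_0: "\<rho> 0 = fst z" and \<rho>_Suc: "\<rho> (Suc k) = \<rho> k + (\<theta> * A) * \<rho> k powr \<alpha>" for k
    by (simp_all add: \<rho>_def)
  have \<theta>A: "0 < \<theta> * A" using \<theta> A by simp
  obtain c where c: "0 < c" "\<And>k. c * real k \<le> \<rho> k powr (1 - \<alpha>)"
    by (rule sublinear_recursion_growth[of \<alpha> "\<theta> * A" \<rho>]) (use \<alpha> \<theta>A x0 \<rho>_0 \<rho>_Suc in auto)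
  define R where "R k = A * \<rho> k powr \<alpha>" for k
  define t where "t = rec_nat 0 (\<lambda>k s. s + (\<theta> * R k)\<^sup>2)"
  have t_0: "t 0 = 0" and t_Suc: "t (Suc k) = t k + (\<theta> * R k)\<^sup>2" for k
    by (simp_all add: t_def)
  have \<rho>_ge: "fst z \<le> \<rho> k" for k
  proof (induction k)
    case (Suc k)
    have "0 \<le> (\<theta> * A) * \<rho> k powr \<alpha>" using \<theta>A by simp
    then show ?case using Suc \<rho>_Suc[of k] by linarith
  qed (simp add: \<rho>_0)
  have R_pos: "0 < R k" for k using \<rho>_ge[of k] x0 A by (simp add: R_def)
  have t_nonneg: "0 \<le> t k" for k by (induction k) (auto simp: t_0 t_Suc)
  have R_mono: "R k \<le> R (Suc k)" for k
    unfolding R_def using A \<alpha> \<theta>A \<rho>_ge[of k] x0 by (intro mult_left_mono powr_mono2) (auto simp: \<rho>_Suc)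
  \<comment> \<open>The lateral bound survives every step without accumulating: a coordinate that
    moves by at most \<open>m * R k\<close> against its sign ends with absolute value at most the
    larger of its old one and \<open>m * R k\<close>. The summand \<open>m * R k\<close> absorbs
    overshooting zero.\<close>
  define E where "E k = stays_in P (t k) \<inter> ({\<omega>\<in>space (past (t k)). \<rho> k \<le> fst (B (t k) \<omega>)}
      \<inter> (\<Inter>j. {\<omega>\<in>space (past (t k)). \<bar>snd (B (t k) \<omega>) $ j\<bar> \<le> \<bar>snd z $ j\<bar> + m * R k}))" for k
  define F where "F k s = E k \<inter> (\<Inter>j. {\<omega>\<in>space (past (t k)). s j = (0 \<le> snd (B (t k) \<omega>) $ j)})" for k s
  define G where "G k s = {\<omega>\<in>space M. (1 / sqrt ((\<theta> * R k)\<^sup>2)) *\<^sub>R (B (t k + (\<theta> * R k)\<^sup>2) \<omega> - B (t k) \<omega>) \<in> S s}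
      \<inter> small_increments (t k) ((\<theta> * R k)\<^sup>2) (K * sqrt ((\<theta> * R k)\<^sup>2))" for k s
  have Bt: "B (t k) \<in> borel_measurable (past (t k))" for k
    using t_nonneg by (intro past_measurable) auto
  have fst_meas: "fst \<in> borel_measurable (borel :: (real \<times> (real ^ 'm)) measure)"
    by (intro borel_measurable_continuous_onI continuous_intros)
  have nth_meas: "(\<lambda>y. snd y $ j) \<in> borel_measurable (borel :: (real \<times> (real ^ 'm)) measure)" for j
    by (intro borel_measurable_continuous_onI continuous_intros)
  note Bt_meas = measurable_compose[OF Bt fst_meas] measurable_compose[OF Bt nth_meas]
  have E_past: "E k \<in> sets (past (t k))" for k
    unfolding E_def
    by (intro sets.Int parabola_stays_past t_nonneg borel_measurable_le borel_measurable_const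
        Bt_meas borel_measurable_abs sets.finite_INT finite_UNIV) auto
  have F_past: "F k s \<in> sets (past (t k))" for k s
  proof -
    have "{\<omega>\<in>space (past (t k)). s j = (0 \<le> snd (B (t k) \<omega>) $ j)} \<in> sets (past (t k))" for j
      by (cases "s j") (simp_all del: space_past add: not_le
          borel_measurable_le[OF borel_measurable_const Bt_meas(2)]
          borel_measurable_less[OF Bt_meas(2) borel_measurable_const])
    then show ?thesis
      unfolding F_def by (intro sets.Int E_past sets.finite_INT) auto
  qed
  have G_fut: "G k s \<in> sets (future (t k))" for k s
  proof -
    let ?X = "\<lambda>\<omega>. (1 / sqrt ((\<theta> * R k)\<^sup>2)) *\<^sub>R (B (t k + (\<theta> * R k)\<^sup>2) \<omega> - B (t k) \<omega>)"
    have "?X -` S s \<inter> space (future (t k)) \<in> sets (future (t k))"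
      by (rule measurable_sets[OF borel_measurable_scaleR[OF borel_measurable_const future_measurable]])
        (use S_open in auto)
    also have "?X -` S s \<inter> space (future (t k)) = {\<omega>\<in>space M. ?X \<omega> \<in> S s}" by auto
    finally show ?thesis
      unfolding G_def by (intro sets.Int small_increments_future t_nonneg)
  qed
  have G_prob: "p \<le> prob (G k s)" for k s
    unfolding G_def using \<theta> R_pos[of k] by (intro pK(3) t_nonneg) auto
  have Ee: "E k \<in> events" for k using E_past past_events by blast
  have Fe: "F k s \<in> events" for k s using F_past past_events by blast
  have Ge: "G k s \<in> events" for k s using G_fut future_events[OF t_nonneg] by blast
  have UF: "(\<Union>s. F k s) = E k" for k
  proof
    show "E k \<subseteq> (\<Union>s. F k s)"
      using Ee[of k, THEN sets.sets_into_space] by (auto simp: F_def intro!: exI[of _ "\<lambda>j. 0 \<le> snd (B (t k) _) $ j"])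
  qed (auto simp: F_def)
  have disj: "s = s'" if "\<omega> \<in> F k s" "\<omega> \<in> F k s'" for k s s' \<omega>
    using that by (auto simp: F_def)
  have step: "F k s \<inter> G k s \<subseteq> E (Suc k)" for k s
  proof
    fix \<omega> assume FG: "\<omega> \<in> F k s \<inter> G k s"
    then have \<omega>: "\<omega> \<in> space M" by (auto simp: G_def)
    let ?T = "(\<theta> * R k)\<^sup>2" and ?u = "t (Suc k)"
    have "0 \<le> \<theta> * R k" using \<theta> R_pos[of k] by simp
    then have "sqrt ?T = \<theta> * R k" by (simp only: real_sqrt_abs abs_of_nonneg)
    moreover have "K * (\<theta> * R k) = m * R k" using pK(2) by (simp add: \<theta>_def)
    ultimately have sqrtT: "sqrt ?T = \<theta> * R k" "K * (\<theta> * R k) = m * R k" by auto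
    have stays: "\<And>v. 0 \<le> v \<Longrightarrow> v \<le> t k \<Longrightarrow> B v \<omega> \<in> P"
      and fst_ge: "\<rho> k \<le> fst (B (t k) \<omega>)"
      and coord: "\<And>j. \<bar>snd (B (t k) \<omega>) $ j\<bar> \<le> \<bar>snd z $ j\<bar> + m * R k"
      and sign: "\<And>j. s j = (0 \<le> snd (B (t k) \<omega>) $ j)"
      using FG by (auto simp: F_def E_def stays_in_def)
    have inS: "(1 / (\<theta> * R k)) *\<^sub>R (B ?u \<omega> - B (t k) \<omega>) \<in> S s"
      and small: "\<And>v. t k \<le> v \<Longrightarrow> v \<le> ?u \<Longrightarrow> norm (B v \<omega> - B (t k) \<omega>) \<le> m * R k"
      using FG unfolding G_def small_increments_def t_Suc sqrtT by auto
    have \<theta>R: "0 < \<theta> * R k" using \<theta> R_pos by simp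
    have small_fst: "\<bar>fst (B v \<omega>) - fst (B (t k) \<omega>)\<bar> \<le> m * R k"
      and small_snd: "norm (snd (B v \<omega>) - snd (B (t k) \<omega>)) \<le> m * R k"
      if "t k \<le> v" "v \<le> ?u" for v
    proof -
      obtain d e where de: "B v \<omega> - B (t k) \<omega> = (d, e)" by (cases "B v \<omega> - B (t k) \<omega>")
      then have "fst (B v \<omega>) - fst (B (t k) \<omega>) = d" "snd (B v \<omega>) - snd (B (t k) \<omega>) = e"
        by (simp_all flip: fst_diff snd_diff)
      then show "\<bar>fst (B v \<omega>) - fst (B (t k) \<omega>)\<bar> \<le> m * R k" "norm (snd (B v \<omega>) - snd (B (t k) \<omega>)) \<le> m * R k"
        using small[OF that] norm_fst_le[of d e] norm_snd_le[of e d] unfolding de by auto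
    qed
    have norm_tk: "norm (snd (B (t k) \<omega>)) \<le> norm (snd z) + real CARD('m) * (m * R k)"
    proof -
      have mR: "0 \<le> m * R k" using m(1) R_pos[of k] by simp
      have "norm (snd (B (t k) \<omega>)) \<le> norm (\<chi> j. \<bar>snd z $ j\<bar> + m * R k)"
        using coord mR by (intro norm_le_componentwise_cart) (auto intro: abs_ge_self order_trans)
      also have "(\<chi> j. \<bar>snd z $ j\<bar> + m * R k) = (\<chi> j. \<bar>snd z $ j\<bar>) + (\<chi> j. m * R k)"
        by (simp add: vec_eq_iff)
      also have "norm \<dots> \<le> norm (\<chi> j. \<bar>snd z $ j\<bar>) + norm (\<chi> (j::'m). m * R k)"
        by (rule norm_triangle_ineq)
      also have "\<dots> \<le> norm (snd z) + (\<Sum>j\<in>(UNIV :: 'm set). \<bar>m * R k\<bar>)"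
        using norm_le_l1_cart[of "\<chi> (j::'m). m * R k"]
        by (intro add_mono norm_le_componentwise_cart) auto
      finally show ?thesis using mR by simp
    qed
    have later: "B v \<omega> \<in> P" if v: "t k \<le> v" "v \<le> ?u" for v
    proof -
      have lower: "\<rho> k - m * R k \<le> fst (B v \<omega>)" using small_fst[OF v] fst_ge by linarith
      have pos: "0 < \<rho> k - m * R k" using m(2)[OF \<rho>_ge] by (simp add: R_def)
      have "norm (snd (B v \<omega>)) \<le> norm (snd (B (t k) \<omega>)) + norm (snd (B v \<omega>) - snd (B (t k) \<omega>))"
        by (metis add.commute diff_add_cancel norm_triangle_ineq)
      also have "\<dots> \<le> norm (snd z) + (real CARD('m) + 1) * (m * R k)"
        using norm_tk small_snd[OF v] by (simp add: algebra_simps)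
      also have "\<dots> < A * (\<rho> k - m * R k) powr \<alpha>"
        using m(3)[OF \<rho>_ge] by (simp add: R_def)
      also have "\<dots> \<le> A * fst (B v \<omega>) powr \<alpha>"
        using lower pos A \<alpha> by (intro mult_left_mono powr_mono2) auto
      finally show ?thesis
        using lower pos by (simp add: parabolic_region_def case_prod_beta)
    qed
    have "\<omega> \<in> stays_in P ?u"
      using \<omega> stays later unfolding stays_in_def by (auto simp: not_le) (meson linear)
    moreover have "\<rho> (Suc k) \<le> fst (B ?u \<omega>)"
    proof -
      have "1 < (fst (B ?u \<omega>) - fst (B (t k) \<omega>)) / (\<theta> * R k)"
        using inS by (simp add: S_def diff_divide_distrib)
      then have "\<theta> * R k < fst (B ?u \<omega>) - fst (B (t k) \<omega>)"
        using \<theta>R by (simp add: pos_less_divide_eq)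
      then show ?thesis using fst_ge by (simp add: \<rho>_Suc R_def mult.assoc)
    qed
    moreover have "\<bar>snd (B ?u \<omega>) $ j\<bar> \<le> \<bar>snd z $ j\<bar> + m * R (Suc k)" for j
    proof -
      let ?d = "snd (B ?u \<omega>) $ j - snd (B (t k) \<omega>) $ j"
      have "0 < (if s j then - 1 else 1) * (?d / (\<theta> * R k))"
        using inS by (simp add: S_def diff_divide_distrib)
      then have dir: "if s j then ?d < 0 else 0 < ?d"
        using \<theta>R by (auto simp: zero_less_divide_iff divide_less_0_iff split: if_splits)
      have "\<bar>?d\<bar> \<le> m * R k"
        using component_le_norm_cart[of "snd (B ?u \<omega>) - snd (B (t k) \<omega>)" j] small_snd[of ?u]
        by (simp add: t_Suc)
      then have "\<bar>snd (B ?u \<omega>) $ j\<bar> \<le> \<bar>snd z $ j\<bar> + m * R k"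
        using dir sign[of j] coord[of j] by (auto split: if_splits)
      also have "\<dots> \<le> \<bar>snd z $ j\<bar> + m * R (Suc k)"
        using m(1) R_mono by (intro add_left_mono mult_left_mono) auto
      finally show ?thesis .
    qed
    ultimately show "\<omega> \<in> E (Suc k)" using \<omega> unfolding E_def by auto
  qed
  have E_prob: "p ^ k \<le> prob (E k)" for k
  proof (induction k)
    case 0
    have "E 0 = space M"
      using z m(1) R_pos[of 0] by (auto simp: E_def stays_in_def t_0 B_0 \<rho>_0)
    then show ?case by (simp add: prob_space)
  next
    case (Suc k)
    \<comment> \<open>The sign patterns partition \<open>E k\<close>; on each piece the matching
      increment event is independent of the past and costs a factor of at least
      \<open>p\<close>.\<close>
    have "p ^ Suc k \<le> p * prob (E k)" using Suc pK(1) by simp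
    also have "prob (E k) = (\<Sum>s\<in>UNIV. prob (F k s))"
      unfolding UF[symmetric] using Fe disj
      by (intro finite_measure_finite_Union) (auto simp: disjoint_family_on_def)
    also have "p * (\<Sum>s\<in>UNIV. prob (F k s)) = (\<Sum>s\<in>UNIV. prob (F k s) * p)"
      by (simp add: sum_distrib_left mult.commute)
    also have "\<dots> \<le> (\<Sum>s\<in>UNIV. prob (F k s) * prob (G k s))"
      using G_prob by (intro sum_mono mult_left_mono) auto
    also have "\<dots> = (\<Sum>s\<in>UNIV. prob (F k s \<inter> G k s))"
      by (intro sum.cong refl indep_past_future[symmetric, OF t_nonneg F_past G_fut])
    also have "\<dots> = prob (\<Union>s. F k s \<inter> G k s)"
      using Fe Ge disj
      by (intro finite_measure_finite_Union[symmetric]) (auto simp: disjoint_family_on_def)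
    also have "\<dots> \<le> prob (E (Suc k))"
      using step Ee by (intro finite_measure_mono) auto
    finally show ?case .
  qed
  show thesis
  proof (rule that[OF pK(1) c(1)])
    fix k
    have "\<rho> k \<le> norm (B (t k) \<omega>)" if "\<omega> \<in> E k" for \<omega>
      using that norm_fst_le[of "fst (B (t k) \<omega>)" "snd (B (t k) \<omega>)"] by (auto simp: E_def)
    then show "\<exists>\<rho> t. \<exists>E\<in>events. 0 < \<rho> \<and> c * real k \<le> \<rho> powr (1 - \<alpha>) \<and> 0 \<le> t \<and> p ^ k \<le> prob E
      \<and> E \<subseteq> stays_in P t \<and> (\<forall>\<omega>\<in>E. \<rho> \<le> norm (B t \<omega>))"
      using Ee[of k] E_prob[of k] c(2)[of k] t_nonneg[of k] \<rho>_ge[of k] x0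
      by (intro exI[of _ "\<rho> k"] exI[of _ "t k"] bexI[of _ "E k"]) (auto simp: E_def)
  qed
qed

end

section \<open>Comparison of exponential moments\<close>

text \<open>Geometric growth with ratio \<open>exp 1 \<ge> 2\<close>: doubling a term stays below
  the next one.\<close>

lemma sum_exp_le: "(\<Sum>k<n. exp (real k + 1)) \<le> exp (real n + 1)"
proof (induction n)
  case (Suc n)
  have "exp (real n + 1) + exp (real n + 1) \<le> exp 1 * exp (real n + 1)"
    using exp_ge_add_one_self[of "1::real"] mult_right_mono[of 2 "exp 1" "exp (real n + 1)"] by simp
  also have "\<dots> = exp (real (Suc n) + 1)" by (simp add: exp_add[symmetric])
  finally show ?case using Suc by simp
qed simp

lemma sum_exp_cutoff_le:
  fixes v :: real
  shows "(\<Sum>k<n. if real k \<le> v then exp (real k + 1) else 0) \<le> exp (v + 2)"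
proof (induction n)
  case (Suc n)
  show ?case
  proof (cases "real n \<le> v")
    case True
    have "(\<Sum>k<Suc n. if real k \<le> v then exp (real k + 1) else 0) \<le> (\<Sum>k<Suc n. exp (real k + 1))"
      by (intro sum_mono) auto
    also have "\<dots> \<le> exp (real (Suc n) + 1)" by (rule sum_exp_le)
    also have "\<dots> \<le> exp (v + 2)" using True by simp
    finally show ?thesis .
  qed (use Suc in simp)
qed simp

text \<open>A layer-cake comparison at integer levels. Above the threshold \<open>N\<close>,
  \<open>exp W\<close> is at most the sum of \<open>exp (k + 1)\<close> over the \<open>U k\<close>
  that occur, and the same sum over the \<open>Q k\<close> is at most
  \<open>exp (V + \<kappa> + 2)\<close>. \<open>V\<close> and \<open>W\<close> enter only through
  pointwise bounds, so measurability of the functionals is not at stake.\<close>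

lemma (in prob_space) exp_moment_transfer:
  fixes V W :: "'a \<Rightarrow> real" and U Q :: "nat \<Rightarrow> 'a set"
  assumes c: "0 < c"
    and events: "\<And>k. N \<le> k \<Longrightarrow> U k \<in> events" "\<And>k. N \<le> k \<Longrightarrow> Q k \<in> events"
    and UQ: "\<And>k. N \<le> k \<Longrightarrow> c * prob (U k) \<le> prob (Q k)"
    and WU: "AE \<omega> in M. \<forall>k\<ge>N. real k < W \<omega> \<longrightarrow> \<omega> \<in> U k"
    and QV: "\<And>k \<omega>. N \<le> k \<Longrightarrow> \<omega> \<in> Q k \<Longrightarrow> real k - \<kappa> \<le> V \<omega>"
    and fin: "(\<integral>\<^sup>+\<omega>. ennreal (exp (V \<omega>)) \<partial>M) < \<infinity>"
  shows "(\<integral>\<^sup>+\<omega>. ennreal (exp (W \<omega>)) \<partial>M) < \<infinity>"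
proof -
  define D where "D = exp (\<kappa> + 2)"
  have D: "0 < D" by (simp add: D_def)
  \<comment> \<open>Levels below \<open>N\<close> carry no information about \<open>U k\<close> and
    \<open>Q k\<close>; they become empty, and the constant \<open>exp N\<close> covers
    them.\<close>
  define U' where "U' k = (if N \<le> k then U k else {})" for k
  define Q' where "Q' k = (if N \<le> k then Q k else {})" for k
  have [measurable]: "U' k \<in> events" "Q' k \<in> events" for k
    using events by (auto simp: U'_def Q'_def)
  let ?H = "\<lambda>\<omega>. \<Sum>k. ennreal (exp (real k + 1) / D) * indicator (Q' k) \<omega>"
  have "?H \<omega> \<le> ennreal (exp (V \<omega>))" for \<omega>
  proof (rule suminf_le_const)
    fix n
    have "(\<Sum>k<n. ennreal (exp (real k + 1) / D) * indicator (Q' k) \<omega>)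
        \<le> (\<Sum>k<n. ennreal ((if real k \<le> V \<omega> + \<kappa> then exp (real k + 1) else 0) / D))"
    proof (rule sum_mono)
      fix k
      show "ennreal (exp (real k + 1) / D) * indicator (Q' k) \<omega>
          \<le> ennreal ((if real k \<le> V \<omega> + \<kappa> then exp (real k + 1) else 0) / D)"
        using QV[of k \<omega>] by (auto simp: Q'_def split: split_indicator)
    qed
    also have "\<dots> = ennreal ((\<Sum>k<n. if real k \<le> V \<omega> + \<kappa> then exp (real k + 1) else 0) / D)"
      unfolding sum_divide_distrib using D by (intro sum_ennreal) auto
    also have "\<dots> \<le> ennreal (exp (V \<omega> + \<kappa> + 2) / D)"
      using sum_exp_cutoff_le[where n = n and v = "V \<omega> + \<kappa>"] D by (intro ennreal_leI divide_right_mono) auto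
    also have "exp (V \<omega> + \<kappa> + 2) / D = exp (V \<omega>)"
      unfolding D_def by (simp add: exp_diff[symmetric])
    finally show "(\<Sum>k<n. ennreal (exp (real k + 1) / D) * indicator (Q' k) \<omega>) \<le> ennreal (exp (V \<omega>))" .
  qed simp
  then have "(\<integral>\<^sup>+\<omega>. ?H \<omega> \<partial>M) \<le> (\<integral>\<^sup>+\<omega>. ennreal (exp (V \<omega>)) \<partial>M)"
    by (intro nn_integral_mono) auto
  then have H_fin: "(\<integral>\<^sup>+\<omega>. ?H \<omega> \<partial>M) < \<infinity>" using fin by (rule le_less_trans)
  have H_eq: "(\<integral>\<^sup>+\<omega>. ?H \<omega> \<partial>M) = (\<Sum>k. ennreal (exp (real k + 1) / D) * emeasure M (Q' k))"
    by (subst nn_integral_suminf) (auto simp: nn_integral_cmult_indicator)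
  let ?G = "\<lambda>\<omega>. \<Sum>k. ennreal (exp (real k + 1)) * indicator (U' k) \<omega>"
  have "(\<integral>\<^sup>+\<omega>. ennreal (exp (W \<omega>)) \<partial>M) \<le> (\<integral>\<^sup>+\<omega>. ennreal (exp (real N)) + ?G \<omega> \<partial>M)"
  proof (rule nn_integral_mono_AE, use WU in eventually_elim)
    case (elim \<omega>)
    show ?case
    proof (cases "W \<omega> \<le> real N")
      case True
      then have "ennreal (exp (W \<omega>)) \<le> ennreal (exp (real N))" by (intro ennreal_leI) auto
      then show ?thesis by (rule order_trans) simp
    next
      case False
      \<comment> \<open>The integer with \<open>k < W \<omega> \<le> k + 1\<close>: ceiling minus
        one keeps the left inequality strict, as \<open>WU\<close> demands, even for integral
        \<open>W \<omega>\<close>.\<close>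
      define k where "k = nat (\<lceil>W \<omega>\<rceil> - 1)"
      have k: "N \<le> k" "real k < W \<omega>" "W \<omega> \<le> real k + 1"
        using False unfolding k_def by linarith+
      then have "\<omega> \<in> U' k" using elim by (auto simp: U'_def)
      then have "ennreal (exp (W \<omega>)) \<le> (\<Sum>k\<in>{k}. ennreal (exp (real k + 1)) * indicator (U' k) \<omega>)"
        using k(3) by (simp add: ennreal_leI)
      also have "\<dots> \<le> ?G \<omega>" by (rule sum_le_suminf) auto
      finally show ?thesis by (rule order_trans) simp
    qed
  qed
  also have "\<dots> = ennreal (exp (real N)) + (\<integral>\<^sup>+\<omega>. ?G \<omega> \<partial>M)"
    by (subst nn_integral_add) (auto simp: emeasure_space_1)
  also have "(\<integral>\<^sup>+\<omega>. ?G \<omega> \<partial>M) = (\<Sum>k. ennreal (exp (real k + 1)) * emeasure M (U' k))"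
    by (subst nn_integral_suminf) (auto simp: nn_integral_cmult_indicator)
  also have "\<dots> \<le> (\<Sum>k. ennreal (D / c) * (ennreal (exp (real k + 1) / D) * emeasure M (Q' k)))"
  proof (rule suminf_le)
    fix k
    have "c * prob (U' k) \<le> prob (Q' k)" using UQ by (simp add: U'_def Q'_def)
    then have "exp (real k + 1) * prob (U' k) \<le> D / c * (exp (real k + 1) / D * prob (Q' k))"
      using c D by (simp add: field_simps)
    then show "ennreal (exp (real k + 1)) * emeasure M (U' k)
        \<le> ennreal (D / c) * (ennreal (exp (real k + 1) / D) * emeasure M (Q' k))"
      using c D unfolding emeasure_eq_measure by (simp add: ennreal_mult'[symmetric] ennreal_leI)
  qed auto
  also have "\<dots> = ennreal (D / c) * (\<integral>\<^sup>+\<omega>. ?H \<omega> \<partial>M)"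
    unfolding H_eq by (rule ennreal_suminf_cmult)
  also have "ennreal (exp (real N)) + \<dots> < \<infinity>"
    using H_fin by (simp add: ennreal_mult_less_top)
  finally show ?thesis by simp
qed

text \<open>Write \<open>r - C r^\<alpha> = r (1 - u)\<close>. Since \<open>a \<le> 1\<close>,
  \<open>(1 - u)^a \<ge> 1 - u\<close>, and the loss \<open>r^a u = C r^(a+\<alpha>-1)\<close> is at
  most \<open>C\<close> because the exponent is nonpositive and \<open>r \<ge> 1\<close>.\<close>

lemma powr_perturb:
  fixes a \<alpha> C r :: real
  assumes "0 < a" "a \<le> 1 - \<alpha>" "0 < \<alpha>" "0 \<le> C" "1 \<le> r" "C * r powr \<alpha> \<le> r"
  shows "r powr a - C \<le> (r - C * r powr \<alpha>) powr a"
proof -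
  define u where "u = C * r powr (\<alpha> - 1)"
  have eq: "r - C * r powr \<alpha> = r * (1 - u)"
    using assms by (simp add: u_def powr_diff field_simps)
  have u: "0 \<le> u" "u \<le> 1"
    using assms by (auto simp: u_def powr_diff divide_le_eq)
  have "r powr a * u = C * r powr (a + \<alpha> - 1)"
    by (simp add: u_def powr_add[symmetric] algebra_simps)
  also have "\<dots> \<le> C * 1"
    using assms powr_mono[of "a + \<alpha> - 1" 0 r] by (intro mult_left_mono) auto
  finally have "r powr a - C \<le> r powr a * (1 - u)" by (simp add: algebra_simps)
  also have "\<dots> \<le> r powr a * (1 - u) powr a"
    using u assms powr_mono'[of a 1 "1 - u"] by (intro mult_left_mono) auto
  also have "\<dots> = (r - C * r powr \<alpha>) powr a"
    unfolding eq using u assms by (simp add: powr_mult)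
  finally show ?thesis .
qed

section \<open>The regimes \<open>a \<le> 1 - \<alpha>\<close> and
  \<open>a > 1 - \<alpha>\<close>\<close>

context parabola_brownian
begin

abbreviation exit_moment :: "real \<Rightarrow> real \<Rightarrow> ennreal" where
  "exit_moment a b \<equiv> \<integral>\<^sup>+\<omega>. ennreal (exp (b * norm (exit_position P B \<omega>) powr a)) \<partial>M"

abbreviation maximal_moment :: "real \<Rightarrow> real \<Rightarrow> ennreal" where
  "maximal_moment a b \<equiv> \<integral>\<^sup>+\<omega>. ennreal (exp (b * maximal_norm_before_exit P B \<omega> powr a)) \<partial>M"

lemma exit_moment_le_maximal_moment:
  assumes "0 < a" "0 < b"
  shows "exit_moment a b \<le> maximal_moment a b"
proof (rule nn_integral_mono_AE, use AE_exit AE_space in eventually_elim)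
  case (elim \<omega>)
  have "norm (exit_position P B \<omega>) \<le> maximal_norm_before_exit P B \<omega>"
    using elim by (intro norm_exit_position_le[OF open_parabolic_region z]) auto
  then show ?case
    using assms by (auto intro!: ennreal_leI powr_mono2)
qed

lemma maximal_moment_finite:
  assumes a: "0 < a" "a \<le> 1 - \<alpha>" and b: "0 < b" and fin: "exit_moment a b < \<infinity>"
  shows "maximal_moment a b < \<infinity>"
proof -
  obtain c C r0 where cC: "0 < c" "0 < C" and ex: "\<And>r. r0 \<le> r \<Longrightarrow> \<exists>U\<in>events. \<exists>Q\<in>events. c * prob U \<le> prob Q
    \<and> (\<forall>\<omega>\<in>space M. \<forall>t\<ge>0. \<omega> \<in> stays_in P t \<longrightarrow> r < norm (B t \<omega>) \<longrightarrow> \<omega> \<in> U)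
    \<and> (\<forall>\<omega>\<in>Q. r - C * r powr \<alpha> \<le> norm (exit_position P B \<omega>))"
    using exit_radius by blast
  define good where "good r U Q \<longleftrightarrow> U \<in> events \<and> Q \<in> events \<and> c * prob U \<le> prob Q
    \<and> (\<forall>\<omega>\<in>space M. \<forall>t\<ge>0. \<omega> \<in> stays_in P t \<longrightarrow> r < norm (B t \<omega>) \<longrightarrow> \<omega> \<in> U)
    \<and> (\<forall>\<omega>\<in>Q. r - C * r powr \<alpha> \<le> norm (exit_position P B \<omega>))" for r U Q
  have "\<forall>r. \<exists>UQ. r0 \<le> r \<longrightarrow> good r (fst UQ) (snd UQ)"
    using ex unfolding good_def by fastforce
  then obtain UQ where "\<forall>r. r0 \<le> r \<longrightarrow> good r (fst (UQ r)) (snd (UQ r))"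
    using choice[of "\<lambda>r UQ. r0 \<le> r \<longrightarrow> good r (fst UQ) (snd UQ)"] by blast
  moreover define U Q where "U = (\<lambda>r. fst (UQ r))" and "Q = (\<lambda>r. snd (UQ r))"
  ultimately have good: "good r (U r) (Q r)" if "r0 \<le> r" for r
    using that by simp
  have UQ: "\<And>r. r0 \<le> r \<Longrightarrow> U r \<in> events" "\<And>r. r0 \<le> r \<Longrightarrow> Q r \<in> events"
    "\<And>r. r0 \<le> r \<Longrightarrow> c * prob (U r) \<le> prob (Q r)"
    "\<And>r \<omega> t. r0 \<le> r \<Longrightarrow> \<omega> \<in> space M \<Longrightarrow> 0 \<le> t \<Longrightarrow> \<omega> \<in> stays_in P t \<Longrightarrow> r < norm (B t \<omega>) \<Longrightarrow> \<omega> \<in> U r"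
    "\<And>r \<omega>. r0 \<le> r \<Longrightarrow> \<omega> \<in> Q r \<Longrightarrow> r - C * r powr \<alpha> \<le> norm (exit_position P B \<omega>)"
    using good unfolding good_def by blast+
  \<comment> \<open>Radii with \<open>b * r k powr a = k\<close>, so that they match the integer
    levels of the moment transfer; the loss \<open>C\<close> in \<open>powr_perturb\<close> then
    becomes \<open>\<kappa> = b * C\<close>.\<close>
  define r where "r k = (real k / b) powr (1 / a)" for k
  have "eventually (\<lambda>k. r0 \<le> r k) sequentially" "eventually (\<lambda>k. 1 \<le> r k) sequentially"
    unfolding r_def using a b by real_asymp+
  moreover have "eventually (\<lambda>k. C * r k powr \<alpha> \<le> r k) sequentially"
  proof -
    have "eventually (\<lambda>x. C * x powr \<alpha> \<le> x) at_top" using \<alpha> cC by real_asymp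
    moreover have "filterlim r at_top sequentially" unfolding r_def using a b by real_asymp
    ultimately show ?thesis by (rule eventually_compose_filterlim)
  qed
  ultimately have "eventually (\<lambda>k. r0 \<le> r k \<and> 1 \<le> r k \<and> C * r k powr \<alpha> \<le> r k) sequentially"
    by eventually_elim auto
  then obtain k0 where k0: "\<And>k. k0 \<le> k \<Longrightarrow> r0 \<le> r k" "\<And>k. k0 \<le> k \<Longrightarrow> 1 \<le> r k"
    "\<And>k. k0 \<le> k \<Longrightarrow> C * r k powr \<alpha> \<le> r k"
    unfolding eventually_sequentially by blast
  have level: "b * r k powr a = real k" for k
    using a b by (simp add: r_def powr_powr)
  show ?thesis
  proof (rule exp_moment_transfer[where c = c and N = k0 and U = "\<lambda>k. U (r k)" and Q = "\<lambda>k. Q (r k)" and \<kappa> = "b * C"])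
    show "AE \<omega> in M. \<forall>k\<ge>k0. real k < b * maximal_norm_before_exit P B \<omega> powr a \<longrightarrow> \<omega> \<in> U (r k)"
      using AE_exit AE_space
    proof eventually_elim
      case (elim \<omega>)
      obtain \<tau> where \<tau>: "0 < \<tau>" "\<And>s. 0 \<le> s \<Longrightarrow> s < \<tau> \<Longrightarrow> B s \<omega> \<in> P"
        "maximal_norm_before_exit P B \<omega> = (SUP s\<in>{0..<\<tau>}. norm (B s \<omega>))"
        by (rule exit_finite[OF open_parabolic_region z elim(2,1)]) blast
      have nonneg: "0 \<le> maximal_norm_before_exit P B \<omega>"
        using norm_exit_position_le[OF open_parabolic_region z elim(2,1)] norm_ge_zero order_trans by blast
      show ?case
      proof (intro allI impI)
        fix k assume k: "k0 \<le> k" "real k < b * maximal_norm_before_exit P B \<omega> powr a"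
        have "\<exists>s\<in>{0..<\<tau>}. r k < norm (B s \<omega>)"
        proof (rule ccontr)
          assume "\<not> (\<exists>s\<in>{0..<\<tau>}. r k < norm (B s \<omega>))"
          then have "maximal_norm_before_exit P B \<omega> \<le> r k"
            unfolding \<tau>(3) using \<tau>(1) by (intro cSUP_least) (auto simp: not_less)
          then have "b * maximal_norm_before_exit P B \<omega> powr a \<le> b * r k powr a"
            using nonneg a b by (intro mult_left_mono powr_mono2) auto
          then show False using k level by simp
        qed
        then obtain s where s: "0 \<le> s" "s < \<tau>" "r k < norm (B s \<omega>)" by auto
        then have "\<omega> \<in> stays_in P s" using \<tau>(2) elim by (auto simp: stays_in_def)
        then show "\<omega> \<in> U (r k)" using UQ(4)[OF k0(1)[OF k(1)]] elim s by blast
      qed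
    qed
    show "real k - b * C \<le> b * norm (exit_position P B \<omega>) powr a"
      if k: "k0 \<le> k" "\<omega> \<in> Q (r k)" for k \<omega>
    proof -
      have "r k powr a - C \<le> (r k - C * r k powr \<alpha>) powr a"
        using a \<alpha> cC k0[OF k(1)] by (intro powr_perturb) auto
      also have "\<dots> \<le> norm (exit_position P B \<omega>) powr a"
        using UQ(5)[OF k0(1)[OF k(1)] k(2)] k0(3)[OF k(1)] a by (intro powr_mono2) auto
      finally have "b * (r k powr a - C) \<le> b * norm (exit_position P B \<omega>) powr a"
        using b by (intro mult_left_mono) auto
      then show ?thesis by (simp add: right_diff_distrib level)
    qed
  qed (use UQ k0 cC fin in auto)
qed

text \<open>After \<open>k\<close> steps the distance is at least of order
  \<open>k^(1/(1-\<alpha>))\<close> with probability at least \<open>p^k\<close>, and the exit is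
  comparably far out with probability at least \<open>c p^k\<close>. For large \<open>k\<close> the
  moment is thus at least \<open>c exp (d k^q + k ln p)\<close> with
  \<open>q = a / (1 - \<alpha>) > 1\<close>, which is unbounded.\<close>

lemma exit_moment_infinite:
  assumes a: "1 - \<alpha> < a" and b: "0 < b"
  shows "exit_moment a b = \<infinity>"
proof (rule ccontr)
  assume "exit_moment a b \<noteq> \<infinity>"
  then obtain I where I: "exit_moment a b = ennreal I" "0 \<le> I"
    by (cases "exit_moment a b") auto
  obtain c C r0 where cC: "0 < c" "0 < C" and UQ: "\<And>r. r0 \<le> r \<Longrightarrow> \<exists>U\<in>events. \<exists>Q\<in>events. c * prob U \<le> prob Q
    \<and> (\<forall>\<omega>\<in>space M. \<forall>t\<ge>0. \<omega> \<in> stays_in P t \<longrightarrow> r < norm (B t \<omega>) \<longrightarrow> \<omega> \<in> U)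
    \<and> (\<forall>\<omega>\<in>Q. r - C * r powr \<alpha> \<le> norm (exit_position P B \<omega>))"
    using exit_radius by blast
  obtain p c' where p: "0 < p" "0 < c'"
    "\<And>k. \<exists>\<rho> t. \<exists>E\<in>events. 0 < \<rho> \<and> c' * real k \<le> \<rho> powr (1 - \<alpha>) \<and> 0 \<le> t \<and> p ^ k \<le> prob E
      \<and> E \<subseteq> stays_in P t \<and> (\<forall>\<omega>\<in>E. \<rho> \<le> norm (B t \<omega>))"
    by (rule stay_far_prob) blast
  define \<beta> where "\<beta> = 1 - \<alpha>"
  have \<beta>: "0 < \<beta>" "\<beta> < a" using \<alpha> a by (auto simp: \<beta>_def)
  \<comment> \<open>The \<open>4\<close> arises from two halvings: \<open>r = \<rho> / 2\<close>
    secures the strict inequality \<open>r < norm (B t \<omega>)\<close>, and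
    \<open>C * r powr \<alpha>\<close> takes at most half of \<open>r\<close>.\<close>
  define d where "d = b * ((c' powr (1 / \<beta>)) / 4) powr a"
  define q where "q = a / \<beta>"
  have d: "0 < d" using b p by (simp add: d_def)
  have q: "1 < q" using \<beta> by (simp add: q_def)
  have "eventually (\<lambda>r. r0 \<le> r \<and> C * r powr \<alpha> \<le> r / 2) at_top"
    using \<alpha> cC by (intro eventually_conj eventually_ge_at_top) real_asymp
  then obtain r1 where r1: "\<And>r. r1 \<le> r \<Longrightarrow> r0 \<le> r" "\<And>r. r1 \<le> r \<Longrightarrow> C * r powr \<alpha> \<le> r / 2"
    unfolding eventually_at_top_linorder by blast
  have "eventually (\<lambda>k. 2 * r1 \<le> (c' * real k) powr (1 / \<beta>)) sequentially"
    using p(2) \<beta> by real_asymp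
  moreover have "filterlim (\<lambda>k. c * exp (d * real k powr q + ln p * real k)) at_top sequentially"
    using cC d q by real_asymp
  then have "eventually (\<lambda>k. I < c * exp (d * real k powr q + ln p * real k)) sequentially"
    by (rule filterlim_at_top_dense[THEN iffD1, rule_format])
  ultimately have "eventually (\<lambda>k. False) sequentially"
  proof eventually_elim
    case (elim k)
    obtain \<rho> t E where E: "E \<in> events" "0 < \<rho>" "c' * real k \<le> \<rho> powr \<beta>" "0 \<le> t" "p ^ k \<le> prob E"
      "E \<subseteq> stays_in P t" "\<And>\<omega>. \<omega> \<in> E \<Longrightarrow> \<rho> \<le> norm (B t \<omega>)"
      using p(3)[of k] unfolding \<beta>_def by blast
    have "(c' * real k) powr (1 / \<beta>) \<le> (\<rho> powr \<beta>) powr (1 / \<beta>)"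
      using E(3) p(2) \<beta> by (intro powr_mono2) auto
    then have \<rho>_ge: "(c' * real k) powr (1 / \<beta>) \<le> \<rho>"
      using E(2) \<beta> by (simp add: powr_powr)
    define r where "r = \<rho> / 2"
    have r: "r1 \<le> r" "0 < r" using \<rho>_ge elim E(2) by (auto simp: r_def)
    obtain U Q where UQ': "U \<in> events" "Q \<in> events" "c * prob U \<le> prob Q"
      "\<And>\<omega> t. \<omega> \<in> space M \<Longrightarrow> 0 \<le> t \<Longrightarrow> \<omega> \<in> stays_in P t \<Longrightarrow> r < norm (B t \<omega>) \<Longrightarrow> \<omega> \<in> U"
      "\<And>\<omega>. \<omega> \<in> Q \<Longrightarrow> r - C * r powr \<alpha> \<le> norm (exit_position P B \<omega>)"
      using UQ[OF r1(1)[OF r(1)]] by blast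
    have "E \<subseteq> U"
    proof
      fix \<omega> assume "\<omega> \<in> E"
      then have "r < norm (B t \<omega>)" using E(7)[of \<omega>] r by (simp add: r_def)
      then show "\<omega> \<in> U"
        using UQ'(4) E(4,6) \<open>\<omega> \<in> E\<close> E(1)[THEN sets.sets_into_space] by blast
    qed
    then have "c * p ^ k \<le> c * prob U"
      using E(5) UQ'(1) cC finite_measure_mono[of E U] by (intro mult_left_mono) auto
    then have Q: "c * p ^ k \<le> prob Q" using UQ'(3) by linarith
    have V: "d * real k powr q \<le> b * norm (exit_position P B \<omega>) powr a" if "\<omega> \<in> Q" for \<omega>
    proof -
      have "\<rho> / 4 \<le> r - C * r powr \<alpha>" using r1(2)[OF r(1)] by (simp add: r_def)
      then have "\<rho> / 4 \<le> norm (exit_position P B \<omega>)" using UQ'(5)[OF that] by linarith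
      then have "(c' * real k) powr (1 / \<beta>) / 4 \<le> norm (exit_position P B \<omega>)" using \<rho>_ge by linarith
      then have "((c' * real k) powr (1 / \<beta>) / 4) powr a \<le> norm (exit_position P B \<omega>) powr a"
        using \<beta> by (intro powr_mono2) auto
      moreover have "b * ((c' * real k) powr (1 / \<beta>) / 4) powr a = d * real k powr q"
        using p(2) by (simp add: d_def q_def powr_mult powr_divide powr_powr)
      ultimately show ?thesis using b by (metis mult_left_mono less_imp_le)
    qed
    have "ennreal (exp (d * real k powr q)) * emeasure M Q = (\<integral>\<^sup>+\<omega>. ennreal (exp (d * real k powr q)) * indicator Q \<omega> \<partial>M)"
      using UQ'(2) by (simp add: nn_integral_cmult_indicator)
    also have "\<dots> \<le> exit_moment a b"
      using V by (intro nn_integral_mono) (auto intro!: ennreal_leI split: split_indicator)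
    finally have I_ge: "exp (d * real k powr q) * prob Q \<le> I"
      using I by (simp add: emeasure_eq_measure ennreal_mult'[symmetric])
    have "exp (ln p * real k) = p ^ k"
      using p(1) by (simp add: exp_of_nat2_mult)
    then have "c * exp (d * real k powr q + ln p * real k) = exp (d * real k powr q) * (c * p ^ k)"
      by (simp add: exp_add)
    also have "\<dots> \<le> exp (d * real k powr q) * prob Q"
      using Q by simp
    finally have "c * exp (d * real k powr q + ln p * real k) \<le> I" using I_ge by linarith
    then show False using elim by linarith
  qed
  then show False by simp
qed

end

theorem theorem1:
  fixes M :: "'w measure"
    and B :: "real \<Rightarrow> 'w \<Rightarrow> real \<times> (real ^ 'm)"
    and z :: "real \<times> (real ^ 'm)"
    and A \<alpha> a b :: real
  assumes "0 < \<alpha>" and "\<alpha> < 1" and "0 < A" and "0 < a" and "0 < b"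
    and "z \<in> parabolic_region A \<alpha>"
    and "brownian_motion M z B"
  shows "(\<integral>\<^sup>+\<omega>. ennreal (exp (b * norm (exit_position (parabolic_region A \<alpha>) B \<omega>) powr a)) \<partial>M) < \<infinity>
    \<longleftrightarrow> (\<integral>\<^sup>+\<omega>. ennreal (exp (b * maximal_norm_before_exit (parabolic_region A \<alpha>) B \<omega> powr a)) \<partial>M) < \<infinity>"
proof -
  interpret prob_space M using assms(7) by (simp add: brownian_motion_def)
  interpret parabola_brownian M z B A \<alpha>
    by unfold_locales (use assms in auto)
  show ?thesis
  proof
    assume fin: "exit_moment a b < \<infinity>"
    then have "a \<le> 1 - \<alpha>" using exit_moment_infinite[of a b] assms(5) by force
    then show "maximal_moment a b < \<infinity>" using maximal_moment_finite assms(4,5) fin by blast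
  next
    assume "maximal_moment a b < \<infinity>"
    then show "exit_moment a b < \<infinity>"
      by (rule le_less_trans[OF exit_moment_le_maximal_moment[OF assms(4,5)]])
  qed
qed

end
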